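(* Let $X$ be a sequentially complete Hausdorff locally convex space and $(T(t))_{t\geq 0}$ an eventually uniformly continuous locally equicontinuous semigroup on $X$ with generator $(A,D(A))$. Then \[ \sigma_{\mathrm{bap}}^{\mathrm{seq}}(T(t))\setminus\{0\}=\mathrm{e}^{t\sigma_{\mathrm{bap}}^{\mathrm{seq}}(A)} \] holds for all $t\geq 0$.
   Context: All locally convex spaces have scalar field $\mathbb{C}$. $\Gamma_X$ denotes a fundamental system of seminorms inducing the topology of $X$ (every continuous seminorm is bounded by a constant multiple of a member of $\Gamma_X$), $\mathcal{L}(X)$ the space of continuous linear operators $X\to X$, and $\mathcal{L}_{\mathrm{b}}(X)$ this space with the topology of uniform convergence on bounded subsets of $X$. A semigroup on $X$ is a family $(T(t))_{t\geq 0}$ in $\mathcal{L}(X)$ with $T(0)=\mathrm{id}$ and $T(t+s)=T(t)T(s)$ for all $t,s\geq 0$. It is strongly continuous if $t\mapsto T(t)x$ is continuous $[0,\infty)\to X$ for every $x\in X$. It is eventually uniformly continuous if it is strongly continuous and there is $t_{\mathrm{ev}}\geq 0$ such that $[t_{\mathrm{ev}},\infty)\to\mathcal{L}_{\mathrm{b}}(X)$, $t\mapsto T(t)$, is continuous. It is locally equicontinuous if for all $q\in\Gamma_X$ and $t_0\geq 0$ there are $p\in\Gamma_X$, $C\geq 0$ with $q(T(t)x)\leq Cp(x)$ for all $t\in[0,t_0]$, $x\in X$. The generator $(A,D(A))$ is given by $Ax=\lim_{t\to 0+}\frac{T(t)x-x}{t}$ with $D(A)$ the set of all $x\in X$ for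 which this limit exists in $X$. For a linear operator $(B,D(B))$ on $X$, $\sigma_{\mathrm{bap}}^{\mathrm{seq}}(B)$ is the set of all $\lambda\in\mathbb{C}$ for which there is a bounded sequence $(x_i)_{i\in\mathbb{N}}\subseteq D(B)$ (bounded in $X$) not converging to $0$ with $\lim_{i\to\infty}(B-\lambda)x_i=0$. For $M\subseteq\mathbb{C}$, $\mathrm{e}^{tM}:=\{\mathrm{e}^{t\lambda}\mid\lambda\in M\}$.
   Formalization: At t=0 the identity is stated only if the bounded sequential approximate point spectrum of A is nonempty or X={0}; otherwise it fails (nilpotent translations on L^2(0,1): left side {1}, right side empty). For t>0 nothing is changed. *)

theory Defs
  imports "HOL-Analysis.Analysis"
begin

text \<open>
  Complex vector spaces are given by the library locale \<open>vector_space\<close> over the field of complex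
  numbers, so scalar multiplication is an explicit parameter \<open>smul\<close>. The topology is
  the one of the type class, and \<open>\<Gamma>\<close> is a set of seminorms.
\<close>

definition is_seminorm :: "(complex \<Rightarrow> 'a::ab_group_add \<Rightarrow> 'a) \<Rightarrow> ('a \<Rightarrow> real) \<Rightarrow> bool" where
  "is_seminorm smul p \<longleftrightarrow>
     (\<forall>x. 0 \<le> p x) \<and> (\<forall>c x. p (smul c x) = cmod c * p x) \<and> (\<forall>x y. p (x + y) \<le> p x + p y)"

text \<open>
  \<open>topology_induced\<close> says that the open seminorm balls form a subbase of the topology.
  The Hausdorff property is not included; it is the class \<open>t2_space\<close>.
\<close>

locale locally_convex_space = vector_space smul
  for smul :: "complex \<Rightarrow> 'a::topological_ab_group_add \<Rightarrow> 'a" +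
  fixes \<Gamma> :: "('a \<Rightarrow> real) set"
  assumes seminorms: "p \<in> \<Gamma> \<Longrightarrow> is_seminorm smul p"
    and topology_induced:
      "(open :: 'a set \<Rightarrow> bool) =
         generate_topology {{y. p (y - x) < \<epsilon>} | p x \<epsilon>. p \<in> \<Gamma> \<and> 0 < \<epsilon>}"
    and fundamental:
      "is_seminorm smul q \<Longrightarrow> continuous_on UNIV q \<Longrightarrow>
         \<exists>p\<in>\<Gamma>. \<exists>C\<ge>0. \<forall>x. q x \<le> C * p x"

text \<open>
  Cauchy sequences are taken with respect to the uniformity of the additive topological group:
  \<open>u m - u n\<close> tends to \<open>0\<close> as \<open>m\<close> and \<open>n\<close> tend to infinity independently.
\<close>

definition group_Cauchy :: "(nat \<Rightarrow> 'a::topological_ab_group_add) \<Rightarrow> bool" where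
  "group_Cauchy u \<longleftrightarrow>
     ((\<lambda>(m, n). u m - u n) \<longlongrightarrow> 0) (sequentially \<times>\<^sub>F sequentially)"

definition sequentially_complete :: "'a::topological_ab_group_add itself \<Rightarrow> bool" where
  "sequentially_complete _ \<longleftrightarrow> (\<forall>u :: nat \<Rightarrow> 'a. group_Cauchy u \<longrightarrow> convergent u)"

definition lcs_bounded :: "('a \<Rightarrow> real) set \<Rightarrow> 'a set \<Rightarrow> bool" where
  "lcs_bounded \<Gamma> B \<longleftrightarrow> (\<forall>p\<in>\<Gamma>. bdd_above (p ` B))"

definition cont_linear_ops ::
    "(complex \<Rightarrow> 'a::topological_ab_group_add \<Rightarrow> 'a) \<Rightarrow> ('a \<Rightarrow> 'a) set" where
  "cont_linear_ops smul = {S. Vector_Spaces.linear smul smul S \<and> continuous_on UNIV S}"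

text \<open>
  The topology on the continuous linear operators generated by the open balls of the seminorms
  \<open>S \<mapsto> sup {q (S x) | x \<in> B}\<close>, where \<open>q \<in> \<Gamma>\<close> and \<open>B\<close> is bounded. The set \<open>B\<close> is required to
  be nonempty because the supremum of the empty set of reals is unspecified.
\<close>

definition Lb_topology ::
    "(complex \<Rightarrow> 'a::topological_ab_group_add \<Rightarrow> 'a) \<Rightarrow> ('a \<Rightarrow> real) set \<Rightarrow> ('a \<Rightarrow> 'a) topology" where
  "Lb_topology smul \<Gamma> = topology_generated_by
     {{R \<in> cont_linear_ops smul. (SUP x\<in>B. q (R x - S x)) < \<epsilon>} | S B q \<epsilon>.
        S \<in> cont_linear_ops smul \<and> lcs_bounded \<Gamma> B \<and> B \<noteq> {} \<and> q \<in> \<Gamma> \<and> 0 < \<epsilon>}"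

text \<open>
  A semigroup is a function on the reals of which only the values at \<open>t \<ge> 0\<close> matter.
\<close>

definition op_semigroup ::
    "(complex \<Rightarrow> 'a::topological_ab_group_add \<Rightarrow> 'a) \<Rightarrow> (real \<Rightarrow> 'a \<Rightarrow> 'a) \<Rightarrow> bool" where
  "op_semigroup smul T \<longleftrightarrow>
     (\<forall>t\<ge>0. T t \<in> cont_linear_ops smul) \<and> T 0 = id \<and>
     (\<forall>t\<ge>0. \<forall>s\<ge>0. T (t + s) = T t \<circ> T s)"

definition strongly_continuous :: "(real \<Rightarrow> 'a \<Rightarrow> 'a::topological_space) \<Rightarrow> bool" where
  "strongly_continuous T \<longleftrightarrow> (\<forall>x. continuous_on {0..} (\<lambda>t. T t x))"

definition eventually_uniformly_continuous ::
    "(complex \<Rightarrow> 'a::topological_ab_group_add \<Rightarrow> 'a) \<Rightarrow> ('a \<Rightarrow> real) set \<Rightarrow>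
     (real \<Rightarrow> 'a \<Rightarrow> 'a) \<Rightarrow> bool" where
  "eventually_uniformly_continuous smul \<Gamma> T \<longleftrightarrow>
     strongly_continuous T \<and>
     (\<exists>t\<^sub>e\<^sub>v\<ge>0. continuous_map (top_of_set {t\<^sub>e\<^sub>v..}) (Lb_topology smul \<Gamma>) T)"

definition locally_equicontinuous ::
    "('a \<Rightarrow> real) set \<Rightarrow> (real \<Rightarrow> 'a \<Rightarrow> 'a) \<Rightarrow> bool" where
  "locally_equicontinuous \<Gamma> T \<longleftrightarrow>
     (\<forall>q\<in>\<Gamma>. \<forall>t\<^sub>0\<ge>0. \<exists>p\<in>\<Gamma>. \<exists>C\<ge>0. \<forall>t\<in>{0..t\<^sub>0}. \<forall>x. q (T t x) \<le> C * p x)"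

definition difference_quotient ::
    "(complex \<Rightarrow> 'a::ab_group_add \<Rightarrow> 'a) \<Rightarrow> (real \<Rightarrow> 'a \<Rightarrow> 'a) \<Rightarrow> 'a \<Rightarrow> real \<Rightarrow> 'a" where
  "difference_quotient smul T x t = smul (complex_of_real (1 / t)) (T t x - x)"

definition generator_domain ::
    "(complex \<Rightarrow> 'a::topological_ab_group_add \<Rightarrow> 'a) \<Rightarrow> (real \<Rightarrow> 'a \<Rightarrow> 'a) \<Rightarrow> 'a set" where
  "generator_domain smul T =
     {x. \<exists>y. (difference_quotient smul T x \<longlongrightarrow> y) (at_right 0)}"

definition generator ::
    "(complex \<Rightarrow> 'a \<Rightarrow> 'a) \<Rightarrow> (real \<Rightarrow> 'a \<Rightarrow> 'a) \<Rightarrow>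
     'a::{topological_ab_group_add, t2_space} \<Rightarrow> 'a" where
  "generator smul T x = Lim (at_right 0) (difference_quotient smul T x)"

text \<open>
  The operator \<open>(B, D)\<close> is a total function \<open>B\<close> of which only the values on \<open>D\<close> matter.
\<close>

definition seq_bap_spectrum ::
    "(complex \<Rightarrow> 'a::topological_ab_group_add \<Rightarrow> 'a) \<Rightarrow> ('a \<Rightarrow> real) set \<Rightarrow>
     'a set \<Rightarrow> ('a \<Rightarrow> 'a) \<Rightarrow> complex set" where
  "seq_bap_spectrum smul \<Gamma> D B =
     {\<mu>. \<exists>u :: nat \<Rightarrow> 'a.
        range u \<subseteq> D \<and> lcs_bounded \<Gamma> (range u) \<and> \<not> u \<longlonglongrightarrow> 0 \<and>
        (\<lambda>i. B (u i) - smul \<mu> (u i)) \<longlonglongrightarrow> 0}"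

text \<open>
  For \<open>M = {}\<close> this set is empty even if \<open>t = 0\<close>. The spectrum of a generator can be empty in a
  nonzero space (nilpotent translations on \<open>L\<^sup>2(0,1)\<close>), while that of \<open>T 0 = id\<close> is then \<open>{1}\<close>.
\<close>

definition exp_set :: "real \<Rightarrow> complex set \<Rightarrow> complex set" where
  "exp_set t M = (\<lambda>z. exp (complex_of_real t * z)) ` M"

end

theory Submission
  imports Defs
begin

text \<open>
  For \<open>t > 0\<close> and \<open>\<mu> \<in> \<complex>\<close> the rescaling \<open>s \<mapsto> exp (- t \<mu> s) T (t s)\<close> is again a locally equicontinuous
  semigroup. Up to the factor \<open>t\<close> its generator is \<open>A - \<mu>\<close>, and its time-one map is
  \<open>exp (- t \<mu>) T t\<close>. Hence both inclusions reduce to a semigroup \<open>U\<close>, the time \<open>1\<close> and the spectral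
  values \<open>0\<close> of the generator and \<open>1\<close> of \<open>U 1\<close>.

  From the generator to the operators: \<open>U 1 x - x\<close> telescopes into \<open>n\<close> summands
  \<open>U (k/n) (U (1/n) x - x)\<close>. Equicontinuity bounds each of them by a seminorm of \<open>U (1/n) x - x\<close>, so
  in the limit \<open>U 1 x - x\<close> is bounded by a seminorm of the generator at \<open>x\<close>
  (\<open>unit_time_estimate\<close>). Approximate eigenvectors of \<open>A\<close> for \<open>\<mu>\<close> are therefore approximate
  eigenvectors of \<open>T t\<close> for \<open>exp (t \<mu>)\<close>.

  From the operators to the generator: let \<open>x\<^sub>i\<close> be bounded, not a null sequence, with
  \<open>U 1 x\<^sub>i - x\<^sub>i \<rightarrow> 0\<close>. The Fourier coefficients \<open>y\<^sub>k\<^sub>,\<^sub>i\<close> of the orbits \<open>s \<mapsto> U s x\<^sub>i\<close> on \<open>[0, 1]\<close> are integrals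
  over orbits of rescaled semigroups; they lie in the domain of the generator, and the generator,
  shifted by \<open>2 \<pi> \<i> k\<close>, maps \<open>y\<^sub>k\<^sub>,\<^sub>i\<close> to \<open>U 1 x\<^sub>i - x\<^sub>i\<close> (\<open>difference_quotient_riemann_mean\<close>). So each \<open>k\<close> with
  \<open>y\<^sub>k\<^sub>,\<^sub>i\<close> not tending to \<open>0\<close> gives a spectral value of the generator, and only the existence of such
  a \<open>k\<close> is left. This is where eventual uniform continuity enters: since
  \<open>x\<^sub>i\<close> is close to \<open>U n x\<^sub>i\<close> for every fixed \<open>n\<close>, the orbits are close to \<open>s \<mapsto> U (s + n) x\<^sub>i\<close>, and for
  large \<open>n\<close> these are continuous uniformly in \<open>i\<close> (\<open>almost_periodic_near_zero\<close>). Fejer's theorem then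
  recovers \<open>x\<^sub>i\<close>, up to an error that is small uniformly in the large \<open>i\<close>, from finitely many of the
  Fourier coefficients (\<open>tendsto_zero_if_fourier_coefficients\<close>): if all coefficients tended to \<open>0\<close>, so would
  \<open>x\<^sub>i\<close>.

  For \<open>t = 0\<close> both sides are \<open>{1}\<close>, except that both are empty in the zero space: the last hypothesis
  ensures that \<open>A\<close> has a spectral value otherwise.

  The scalar multiplication being a locale parameter, integrals over \<open>[0, 1]\<close> are
  limits of Riemann sums over equidistant nodes; all estimates are made for the sums. The identities
  needed are then exact already before passing to the limit: the increments of the averaged orbit
  telescope, and the Fejer kernel of order \<open>N\<close> has mean \<open>1\<close> over any \<open>n \<ge> N\<close> equidistant nodes.
\<close>

section \<open>Limits in terms of seminorms\<close>

context locally_convex_space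
begin

lemma seminorm_nonneg: "q \<in> \<Gamma> \<Longrightarrow> 0 \<le> q x"
  and seminorm_smul: "q \<in> \<Gamma> \<Longrightarrow> q (smul c x) = cmod c * q x"
  and seminorm_triangle: "q \<in> \<Gamma> \<Longrightarrow> q (x + y) \<le> q x + q y"
  using seminorms unfolding is_seminorm_def by blast+

lemma seminorm_zero: "q \<in> \<Gamma> \<Longrightarrow> q 0 = 0"
  using seminorm_smul[of q 0 0] by simp

lemma seminorm_minus: "q \<in> \<Gamma> \<Longrightarrow> q (- x) = q x"
  using seminorm_smul[of q "-1" x] by simp

lemma seminorm_diff_commute: "q \<in> \<Gamma> \<Longrightarrow> q (x - y) = q (y - x)"
  using seminorm_minus[of q "x - y"] by simp

lemma seminorm_diff_triangle: "q \<in> \<Gamma> \<Longrightarrow> q (x - z) \<le> q (x - y) + q (y - z)"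
  using seminorm_triangle[of q "x - y" "y - z"] by simp

lemma seminorm_diff_le: "q \<in> \<Gamma> \<Longrightarrow> q (x - y) \<le> q x + q y"
  using seminorm_triangle[of q x "- y"] seminorm_minus[of q y] by simp

lemma seminorm_abs_diff_le: "q \<in> \<Gamma> \<Longrightarrow> \<bar>q x - q y\<bar> \<le> q (x - y)"
  using seminorm_triangle[of q "x - y" y] seminorm_triangle[of q "y - x" x]
    seminorm_diff_commute[of q x y] by simp

lemma seminorm_sum_le: "q \<in> \<Gamma> \<Longrightarrow> q (sum f I) \<le> (\<Sum>i\<in>I. q (f i))"
proof (induction I rule: infinite_finite_induct)
  case (insert i I)
  then show ?case
    using seminorm_triangle[of q "f i" "sum f I"] by simp
qed (simp_all add: seminorm_zero)

lemma open_seminorm_ball: "q \<in> \<Gamma> \<Longrightarrow> 0 < \<epsilon> \<Longrightarrow> open {y. q (y - x) < \<epsilon>}"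
  unfolding topology_induced by (rule generate_topology.Basis) blast

text \<open>
  The seminorm balls, with arbitrary centres, form only a subbase; whence the induction over the
  generated open sets.
\<close>

lemma tendsto_iff_seminorms:
  "(f \<longlongrightarrow> l) F \<longleftrightarrow> (\<forall>q\<in>\<Gamma>. ((\<lambda>i. q (f i - l)) \<longlongrightarrow> 0) F)"
proof (intro iffI ballI)
  fix q assume f: "(f \<longlongrightarrow> l) F" and q: "q \<in> \<Gamma>"
  show "((\<lambda>i. q (f i - l)) \<longlongrightarrow> 0) F"
  proof (rule tendstoI)
    fix \<epsilon> :: real assume "0 < \<epsilon>"
    then have "\<forall>\<^sub>F i in F. f i \<in> {y. q (y - l) < \<epsilon>}"
      using topological_tendstoD[OF f open_seminorm_ball[OF q]] seminorm_zero[OF q] by simp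
    then show "\<forall>\<^sub>F i in F. dist (q (f i - l)) 0 < \<epsilon>"
      by eventually_elim (simp add: seminorm_nonneg[OF q])
  qed
next
  assume f: "\<forall>q\<in>\<Gamma>. ((\<lambda>i. q (f i - l)) \<longlongrightarrow> 0) F"
  show "(f \<longlongrightarrow> l) F"
  proof (rule topological_tendstoI)
    fix S assume "open S" "l \<in> S"
    then have "generate_topology {{y. p (y - x) < \<epsilon>} | p x \<epsilon>. p \<in> \<Gamma> \<and> 0 < \<epsilon>} S"
      unfolding topology_induced by simp
    then show "\<forall>\<^sub>F i in F. f i \<in> S"
      using \<open>l \<in> S\<close>
    proof (induction rule: generate_topology.induct)
      case UNIV
      then show ?case by simp
    next
      case (Int a b)
      then show ?case by (simp add: eventually_conj)
    next
      case (UN K)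
      then obtain k where k: "k \<in> K" "l \<in> k" by auto
      have "\<forall>\<^sub>F i in F. f i \<in> k" using UN(2)[OF k] .
      then show ?case by eventually_elim (use k in blast)
    next
      case (Basis s)
      then obtain q x \<epsilon> where s: "s = {y. q (y - x) < \<epsilon>}" and q: "q \<in> \<Gamma>" by auto
      have "0 < \<epsilon> - q (l - x)" using Basis(2) s by simp
      then have "\<forall>\<^sub>F i in F. q (f i - l) < \<epsilon> - q (l - x)"
        by (rule order_tendstoD(2)[OF bspec[OF f q]])
      then show ?case
        by eventually_elim (use s seminorm_diff_triangle[OF q, of _ x l] in \<open>smt (verit) mem_Collect_eq\<close>)
    qed
  qed
qed

lemma tendsto_seminorm:
  assumes q: "q \<in> \<Gamma>" and "(f \<longlongrightarrow> l) F"
  shows "((\<lambda>i. q (f i)) \<longlongrightarrow> q l) F"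
proof -
  have "((\<lambda>i. q (f i - l)) \<longlongrightarrow> 0) F"
    using assms tendsto_iff_seminorms by blast
  then have "((\<lambda>i. q (f i) - q l) \<longlongrightarrow> 0) F"
    by (rule Lim_null_comparison[rotated]) (simp add: seminorm_abs_diff_le[OF q])
  then show ?thesis by (simp add: LIM_zero_iff)
qed

lemma tendsto_smul:
  assumes a: "(a \<longlongrightarrow> \<alpha>) F" and f: "(f \<longlongrightarrow> v) F"
  shows "((\<lambda>i. smul (a i) (f i)) \<longlongrightarrow> smul \<alpha> v) F"
  unfolding tendsto_iff_seminorms
proof
  fix q assume q: "q \<in> \<Gamma>"
  have eq: "smul (a i) (f i) - smul \<alpha> v = smul (a i) (f i - v) + smul (a i - \<alpha>) v" for i
    by (simp add: scale_right_diff_distrib scale_left_diff_distrib)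
  have le: "q (smul (a i) (f i) - smul \<alpha> v) \<le> cmod (a i) * q (f i - v) + cmod (a i - \<alpha>) * q v" for i
    unfolding eq
    using seminorm_triangle[OF q, of "smul (a i) (f i - v)" "smul (a i - \<alpha>) v"]
    by (simp add: seminorm_smul[OF q])
  have "((\<lambda>i. q (f i - v)) \<longlongrightarrow> 0) F" using f q tendsto_iff_seminorms by blast
  moreover have "((\<lambda>i. cmod (a i - \<alpha>)) \<longlongrightarrow> 0) F"
    using a by (simp add: LIM_zero_iff tendsto_norm_zero_iff)
  ultimately have "((\<lambda>i. cmod (a i) * q (f i - v) + cmod (a i - \<alpha>) * q v) \<longlongrightarrow> cmod \<alpha> * 0 + 0 * q v) F"
    by (intro tendsto_intros a)
  then have "((\<lambda>i. cmod (a i) * q (f i - v) + cmod (a i - \<alpha>) * q v) \<longlongrightarrow> 0) F"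
    by simp
  then show "((\<lambda>i. q (smul (a i) (f i) - smul \<alpha> v)) \<longlongrightarrow> 0) F"
    by (rule Lim_null_comparison[rotated]) (simp add: le seminorm_nonneg[OF q])
qed

lemma sum_constant_smul: "(\<Sum>j<n. x) = smul (of_nat n) x"
  by (induction n) (simp_all add: scale_left_distrib add.commute)

end

section \<open>Riemann means over the unit interval\<close>

context locally_convex_space
begin

definition riemann_mean :: "(real \<Rightarrow> 'a) \<Rightarrow> nat \<Rightarrow> 'a" where
  "riemann_mean f n = smul (1 / of_nat n) (\<Sum>j<n. f (real j / n))"

text \<open>
  The two-variable function \<open>q (f s - f s')\<close> is real-valued and continuous on a compact square, hence
  uniformly continuous, and it vanishes on the diagonal.
\<close>

lemma uniformly_continuous_seminorm:
  assumes f: "continuous_on {0..1} f" and q: "q \<in> \<Gamma>" and "0 < \<epsilon>"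
  obtains \<delta> :: real where "0 < \<delta>"
    "\<And>s s'. s \<in> {0..1} \<Longrightarrow> s' \<in> {0..1} \<Longrightarrow> \<bar>s - s'\<bar> < \<delta> \<Longrightarrow> q (f s - f s') < \<epsilon>"
proof -
  let ?S = "{0..1::real} \<times> {0..1::real}"
  have "continuous_on ?S (\<lambda>z. f (fst z) - f (snd z))"
    by (intro continuous_intros continuous_on_compose2[OF f]) auto
  then have "continuous_on ?S (\<lambda>z. q (f (fst z) - f (snd z)))"
    unfolding continuous_on_def using tendsto_seminorm[OF q] by blast
  then have "uniformly_continuous_on ?S (\<lambda>z. q (f (fst z) - f (snd z)))"
    by (intro compact_uniformly_continuous compact_Times) auto
  then obtain \<delta> where d: "0 < \<delta>" and
    u: "\<And>z z'. z \<in> ?S \<Longrightarrow> z' \<in> ?S \<Longrightarrow> dist z' z < \<delta> \<Longrightarrow>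
       dist (q (f (fst z') - f (snd z'))) (q (f (fst z) - f (snd z))) < \<epsilon>"
    using \<open>0 < \<epsilon>\<close> by (rule uniformly_continuous_onE) metis
  show thesis
  proof
    fix s s' :: real assume "s \<in> {0..1}" "s' \<in> {0..1}" "\<bar>s - s'\<bar> < \<delta>"
    with u[of "(s, s)" "(s, s')"] show "q (f s - f s') < \<epsilon>"
      by (auto simp: dist_Pair_Pair dist_real_def seminorm_zero[OF q] seminorm_nonneg[OF q] abs_minus_commute)
  qed (rule d)
qed

text \<open>
  The nodes \<open>i / (n m)\<close> fall into \<open>n\<close> blocks of \<open>m\<close>, and within a block all are closer than \<open>1 / n\<close> to
  its first node. Any two means are thereby comparable through a common refinement.
\<close>

lemma riemann_mean_refine:
  assumes q: "q \<in> \<Gamma>" and n: "0 < n" and m: "0 < m"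
    and osc: "\<And>s s'. s \<in> {0..1} \<Longrightarrow> s' \<in> {0..1} \<Longrightarrow> \<bar>s - s'\<bar> < 1 / n \<Longrightarrow> q (f s - f s') \<le> \<epsilon>"
  shows "q (riemann_mean f n - riemann_mean f (n * m)) \<le> \<epsilon>"
proof -
  let ?g = "\<lambda>j l. f (real j / n) - f (real (j * m + l) / real (n * m))"
  have "(\<Sum>i<n * m. f (real i / real (n * m))) = (\<Sum>j<n. \<Sum>i\<in>{j*m..<j*m+m}. f (real i / real (n * m)))"
    by (simp add: sum.nat_group)
  also have "\<dots> = (\<Sum>j<n. \<Sum>l<m. f (real (j * m + l) / real (n * m)))"
  proof (rule sum.cong[OF refl])
    fix j
    show "(\<Sum>i\<in>{j*m..<j*m+m}. f (real i / real (n * m))) = (\<Sum>l<m. f (real (j * m + l) / real (n * m)))"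
      by (rule sum.reindex_bij_witness[of _ "\<lambda>l. j * m + l" "\<lambda>i. i - j * m"]) auto
  qed
  finally have fine: "riemann_mean f (n * m) =
      smul (1 / of_nat (n * m)) (\<Sum>j<n. \<Sum>l<m. f (real (j * m + l) / real (n * m)))"
    unfolding riemann_mean_def by simp
  have coarse: "riemann_mean f n = smul (1 / of_nat (n * m)) (\<Sum>j<n. \<Sum>l<m. f (real j / n))"
    using m by (simp add: riemann_mean_def sum_constant_smul flip: scale_sum_right)
  have "riemann_mean f n - riemann_mean f (n * m) = smul (1 / of_nat (n * m)) (\<Sum>j<n. \<Sum>l<m. ?g j l)"
    unfolding fine coarse by (simp add: sum_subtractf flip: scale_right_diff_distrib)
  then have "q (riemann_mean f n - riemann_mean f (n * m)) = q (\<Sum>j<n. \<Sum>l<m. ?g j l) / (n * m)"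
    by (simp add: seminorm_smul[OF q] norm_divide norm_mult)
  moreover have "q (\<Sum>j<n. \<Sum>l<m. ?g j l) \<le> (\<Sum>j<n. \<Sum>l<m. \<epsilon>)"
  proof (rule order.trans[OF seminorm_sum_le[OF q]], rule sum_mono,
      rule order.trans[OF seminorm_sum_le[OF q]], rule sum_mono)
    fix j l assume j: "j \<in> {..<n}" and l: "l \<in> {..<m}"
    have "(j + 1) * m \<le> n * m" using j by (intro mult_right_mono) auto
    then have *: "real (j * m + l) \<le> real (n * m)" using l by (intro of_nat_mono) (simp add: algebra_simps)
    have "real j / n - real (j * m + l) / real (n * m) = - (real l / m) / n"
      using n m by (simp add: field_simps)
    also have "\<bar>\<dots>\<bar> < 1 / n" using l n m by (simp add: abs_mult divide_simps)
    finally show "q (?g j l) \<le> \<epsilon>"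
      using n m j * by (intro osc) (auto simp: divide_simps)
  qed
  ultimately have "q (riemann_mean f n - riemann_mean f (n * m)) \<le> (\<Sum>j<n. \<Sum>l<m. \<epsilon>) / (n * m)"
    by (simp only: divide_right_mono of_nat_0_le_iff)
  then show ?thesis using n m by simp
qed

lemma seminorm_riemann_mean_le:
  assumes q: "q \<in> \<Gamma>" and "0 \<le> M" and f: "\<And>s. s \<in> {0..1} \<Longrightarrow> q (f s) \<le> M"
  shows "q (riemann_mean f n) \<le> M"
proof (cases "n = 0")
  case True
  then show ?thesis using \<open>0 \<le> M\<close> by (simp add: riemann_mean_def seminorm_zero[OF q])
next
  case False
  have "q (\<Sum>j<n. f (real j / n)) \<le> (\<Sum>j<n. M)"
    by (rule order.trans[OF seminorm_sum_le[OF q]], rule sum_mono, rule f) auto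
  then show ?thesis
    using False by (simp add: riemann_mean_def seminorm_smul[OF q] norm_divide divide_simps mult.commute)
qed

lemma convergent_riemann_mean:
  assumes complete: "sequentially_complete TYPE('a)" and f: "continuous_on {0..1} f"
  shows "convergent (riemann_mean f)"
proof -
  have "((\<lambda>z. riemann_mean f (fst z) - riemann_mean f (snd z)) \<longlongrightarrow> 0) (sequentially \<times>\<^sub>F sequentially)"
    unfolding tendsto_iff_seminorms
  proof
    fix q assume q: "q \<in> \<Gamma>"
    show "((\<lambda>z. q (riemann_mean f (fst z) - riemann_mean f (snd z) - 0)) \<longlongrightarrow> 0)
      (sequentially \<times>\<^sub>F sequentially)"
    proof (rule tendstoI)
      fix \<epsilon> :: real assume "0 < \<epsilon>"
      then obtain \<delta> where "0 < \<delta>" and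
        d: "\<And>s s'. s \<in> {0..1} \<Longrightarrow> s' \<in> {0..1} \<Longrightarrow> \<bar>s - s'\<bar> < \<delta> \<Longrightarrow> q (f s - f s') < \<epsilon> / 3"
        using uniformly_continuous_seminorm[OF f q, of "\<epsilon> / 3"] by auto
      have ev: "\<forall>\<^sub>F n in sequentially. 0 < n \<and> 1 / real n < \<delta>"
        using eventually_conj[OF eventually_gt_at_top[of 0] order_tendstoD(2)[OF lim_1_over_n \<open>0 < \<delta>\<close>]]
        by simp
      have "dist (q (riemann_mean f (fst (n, m)) - riemann_mean f (snd (n, m)) - 0)) 0 < \<epsilon>"
        if n: "0 < n \<and> 1 / real n < \<delta>" and m: "0 < m \<and> 1 / real m < \<delta>" for n m :: nat
      proof -
        have "q (riemann_mean f n - riemann_mean f (n * m)) \<le> \<epsilon> / 3"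
          using n m by (intro riemann_mean_refine[OF q] less_imp_le[OF d]) auto
        moreover have "q (riemann_mean f m - riemann_mean f (n * m)) \<le> \<epsilon> / 3"
          unfolding mult.commute[of n m]
          using n m by (intro riemann_mean_refine[OF q] less_imp_le[OF d]) auto
        ultimately have "q (riemann_mean f n - riemann_mean f m) < \<epsilon>"
          using seminorm_diff_triangle[OF q, of "riemann_mean f n" "riemann_mean f m" "riemann_mean f (n * m)"]
            seminorm_diff_commute[OF q, of "riemann_mean f m" "riemann_mean f (n * m)"] \<open>0 < \<epsilon>\<close> by linarith
        then show ?thesis by (simp add: seminorm_nonneg[OF q])
      qed
      then show "\<forall>\<^sub>F z in sequentially \<times>\<^sub>F sequentially.
          dist (q (riemann_mean f (fst z) - riemann_mean f (snd z) - 0)) 0 < \<epsilon>"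
        unfolding eventually_prod_filter
        by (intro exI[of _ "\<lambda>n. 0 < n \<and> 1 / real n < \<delta>"] conjI ev allI impI)
    qed
  qed
  then have "group_Cauchy (riemann_mean f)"
    unfolding group_Cauchy_def by (simp add: case_prod_beta')
  then show ?thesis using complete unfolding sequentially_complete_def by blast
qed

end

section \<open>Locally equicontinuous semigroups and their rescalings\<close>

context locally_convex_space
begin

lemma continuous_on_smul:
  "continuous_on S a \<Longrightarrow> continuous_on S f \<Longrightarrow> continuous_on S (\<lambda>s. smul (a s) (f s))"
  unfolding continuous_on_def by (simp add: tendsto_smul)

definition rescaled :: "complex \<Rightarrow> real \<Rightarrow> (real \<Rightarrow> 'a \<Rightarrow> 'a) \<Rightarrow> real \<Rightarrow> 'a \<Rightarrow> 'a" where
  "rescaled c r T s x = smul (exp (c * complex_of_real s)) (T (r * s) x)"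

text \<open>
  The product rule for \<open>exp (c h) T (r h) x\<close> at \<open>h = 0\<close>.
\<close>

lemma difference_quotient_rescaled:
  assumes r: "0 < r" and v: "(difference_quotient smul T x \<longlongrightarrow> v) (at_right 0)"
  shows "(difference_quotient smul (rescaled c r T) x \<longlongrightarrow> smul (of_real r) v + smul c x) (at_right 0)"
proof -
  have lim_rh: "filterlim (\<lambda>h. r * h) (at_right 0) (at_right (0::real))"
  proof (rule tendsto_imp_filterlim_at_right)
    have "((\<lambda>h. r * h) \<longlongrightarrow> r * 0) (at_right 0)" by (intro tendsto_intros)
    then show "((\<lambda>h. r * h) \<longlongrightarrow> 0) (at_right 0)" by simp
    show "\<forall>\<^sub>F h in at_right 0. 0 < r * h"
      using eventually_at_right_less[of "0::real"] by eventually_elim (simp add: r)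
  qed
  have "((\<lambda>h. exp (c * complex_of_real h)) \<longlongrightarrow> exp (c * complex_of_real 0)) (at_right 0)"
    by (intro tendsto_intros)
  then have lim_exp: "((\<lambda>h. exp (c * complex_of_real h) * of_real r) \<longlongrightarrow> of_real r) (at_right 0)"
    using tendsto_mult_right[of _ 1 _ "of_real r"] by simp
  have "((\<lambda>z. exp (c * z)) has_field_derivative c) (at 0)"
    by (auto intro!: derivative_eq_intros)
  then have "((\<lambda>z. (exp (c * z) - 1) / z) \<longlongrightarrow> c) (at 0)"
    by (simp add: has_field_derivative_iff)
  moreover have "filterlim complex_of_real (at 0) (at_right 0)"
  proof (rule filterlim_atI)
    have "((\<lambda>h. complex_of_real h) \<longlongrightarrow> of_real 0) (at_right 0)" by (intro tendsto_intros)
    then show "(complex_of_real \<longlongrightarrow> 0) (at_right 0)" by simp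
    show "\<forall>\<^sub>F h in at_right 0. complex_of_real h \<noteq> 0"
      using eventually_at_right_less[of "0::real"] by eventually_elim simp
  qed
  ultimately have lim_expm1: "((\<lambda>h. (exp (c * complex_of_real h) - 1) / complex_of_real h) \<longlongrightarrow> c) (at_right 0)"
    by (rule filterlim_compose)
  have "((\<lambda>h. smul (exp (c * complex_of_real h) * of_real r) (difference_quotient smul T x (r * h)) +
      smul ((exp (c * complex_of_real h) - 1) / complex_of_real h) x) \<longlongrightarrow>
      smul (of_real r) v + smul c x) (at_right 0)"
    by (intro tendsto_add tendsto_smul lim_exp lim_expm1 filterlim_compose[OF v lim_rh] tendsto_const)
  moreover have "\<forall>\<^sub>F h in at_right 0.
      smul (exp (c * complex_of_real h) * of_real r) (difference_quotient smul T x (r * h)) +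
      smul ((exp (c * complex_of_real h) - 1) / complex_of_real h) x =
      difference_quotient smul (rescaled c r T) x h"
    using eventually_at_right_less[of "0::real"]
  proof eventually_elim
    case (elim h)
    then show ?case using r
      by (simp add: difference_quotient_def rescaled_def scale_right_diff_distrib
          scale_left_diff_distrib diff_divide_distrib)
  qed
  ultimately show ?thesis by (rule Lim_transform_eventually)
qed

end

locale equicontinuous_semigroup = locally_convex_space smul \<Gamma>
  for smul :: "complex \<Rightarrow> 'a::{topological_ab_group_add, t2_space} \<Rightarrow> 'a" and \<Gamma> +
  fixes U :: "real \<Rightarrow> 'a \<Rightarrow> 'a"
  assumes semigroup: "op_semigroup smul U"
    and strongly_continuous: "strongly_continuous U"
    and locally_equicontinuous: "locally_equicontinuous \<Gamma> U"
begin

lemma linear_U: "0 \<le> s \<Longrightarrow> Vector_Spaces.linear smul smul (U s)"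
  using semigroup by (simp add: op_semigroup_def cont_linear_ops_def)

lemma U_add: "0 \<le> s \<Longrightarrow> U s (x + y) = U s x + U s y"
  and U_smul: "0 \<le> s \<Longrightarrow> U s (smul a x) = smul a (U s x)"
  using linear_U[of s] by (simp_all add: Vector_Spaces.linear_iff)

lemma U_diff: "0 \<le> s \<Longrightarrow> U s (x - y) = U s x - U s y"
  using U_add[of s "x - y" y] by (simp add: algebra_simps)

lemma U_zero: "0 \<le> s \<Longrightarrow> U s 0 = 0"
  using U_diff[of s 0 0] by simp

lemma U_sum: "0 \<le> s \<Longrightarrow> U s (sum f I) = (\<Sum>i\<in>I. U s (f i))"
  by (induction I rule: infinite_finite_induct) (simp_all add: U_zero U_add)

lemma U_0: "U 0 x = x"
  using semigroup by (simp add: op_semigroup_def)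

lemma U_plus: "0 \<le> s \<Longrightarrow> 0 \<le> s' \<Longrightarrow> U (s + s') x = U s (U s' x)"
  using semigroup by (simp add: op_semigroup_def)

lemma continuous_orbit: "continuous_on {0..} (\<lambda>s. U s x)"
  using strongly_continuous by (simp add: strongly_continuous_def)

lemma equicontinuousE:
  assumes "q \<in> \<Gamma>" "0 \<le> t"
  obtains p C where "p \<in> \<Gamma>" "0 \<le> C" "\<And>s x. 0 \<le> s \<Longrightarrow> s \<le> t \<Longrightarrow> q (U s x) \<le> C * p x"
proof -
  obtain p C where "p \<in> \<Gamma>" "0 \<le> C" "\<forall>s\<in>{0..t}. \<forall>x. q (U s x) \<le> C * p x"
    using assms locally_equicontinuous unfolding locally_equicontinuous_def by blast
  then show thesis by (intro that) auto
qed

text \<open>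
  Local equicontinuity as a limit statement: null sequences are mapped to null sequences uniformly for
  times in a compact interval.
\<close>

lemma tendsto_zero_U:
  assumes t: "0 \<le> t" and x: "(x \<longlongrightarrow> 0) F" and q: "q \<in> \<Gamma>" and "0 < \<epsilon>"
  shows "\<forall>\<^sub>F i in F. \<forall>s\<in>{0..t}. q (U s (x i)) < \<epsilon>"
proof -
  obtain p C where p: "p \<in> \<Gamma>" "0 \<le> C" and C: "\<And>s x. 0 \<le> s \<Longrightarrow> s \<le> t \<Longrightarrow> q (U s x) \<le> C * p x"
    using equicontinuousE[OF q t] by blast
  have "((\<lambda>i. C * p (x i)) \<longlongrightarrow> C * p 0) F"
    by (intro tendsto_intros tendsto_seminorm[OF p(1)] x)
  then have "\<forall>\<^sub>F i in F. C * p (x i) < \<epsilon>"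
    using \<open>0 < \<epsilon>\<close> by (intro order_tendstoD(2)) (auto simp: seminorm_zero[OF p(1)])
  then show ?thesis
    by eventually_elim (auto intro: le_less_trans[OF C])
qed

lemma equicontinuous_semigroup_rescaled:
  assumes r: "0 < r"
  shows "equicontinuous_semigroup smul \<Gamma> (rescaled c r U)"
proof unfold_locales
  have "rescaled c r U s \<in> cont_linear_ops smul" if "0 \<le> s" for s
  proof -
    have rs: "0 \<le> r * s" using r that by simp
    have "continuous_on UNIV (U (r * s))"
      using semigroup rs by (simp add: op_semigroup_def cont_linear_ops_def)
    then have "continuous_on UNIV (rescaled c r U s)"
      unfolding rescaled_def by (intro continuous_on_smul continuous_on_const)
    moreover have "Vector_Spaces.linear smul smul (rescaled c r U s)"
      using linear_U[OF rs] unfolding Vector_Spaces.linear_iff rescaled_def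
      by (simp add: scale_right_distrib mult.commute)
    ultimately show ?thesis by (simp add: cont_linear_ops_def)
  qed
  moreover have "rescaled c r U 0 = id"
    by (simp add: fun_eq_iff rescaled_def U_0)
  moreover have "rescaled c r U (s + s') = rescaled c r U s \<circ> rescaled c r U s'" if "0 \<le> s" "0 \<le> s'" for s s'
    using r that by (simp add: fun_eq_iff rescaled_def distrib_left exp_add U_plus U_smul)
  ultimately show "op_semigroup smul (rescaled c r U)"
    by (simp add: op_semigroup_def)
  show "strongly_continuous (rescaled c r U)"
    unfolding strongly_continuous_def
  proof
    fix x
    have "continuous_on {0..} (\<lambda>s. U (r * s) x)"
      by (rule continuous_on_compose2[OF continuous_orbit]) (use r in \<open>auto intro!: continuous_intros\<close>)
    moreover have "continuous_on {0..} (\<lambda>s. exp (c * complex_of_real s))"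
      by (intro continuous_intros)
    ultimately show "continuous_on {0..} (\<lambda>s. rescaled c r U s x)"
      unfolding rescaled_def by (rule continuous_on_smul[rotated])
  qed
  show "locally_equicontinuous \<Gamma> (rescaled c r U)"
    unfolding locally_equicontinuous_def
  proof (intro ballI allI impI)
    fix q and t :: real assume q: "q \<in> \<Gamma>" and t: "0 \<le> t"
    obtain p C where p: "p \<in> \<Gamma>" "0 \<le> C"
      and C: "\<And>s x. 0 \<le> s \<Longrightarrow> s \<le> r * t \<Longrightarrow> q (U s x) \<le> C * p x"
      using equicontinuousE[OF q, of "r * t"] r t by (metis mult_nonneg_nonneg less_imp_le)
    have "q (rescaled c r U s x) \<le> exp (cmod c * t) * C * p x" if "s \<in> {0..t}" for s x
    proof -
      have "cmod (exp (c * complex_of_real s)) \<le> exp (cmod (c * complex_of_real s))"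
        by (rule norm_exp)
      also have "\<dots> \<le> exp (cmod c * t)"
        using that by (auto simp: norm_mult intro: mult_left_mono)
      finally show ?thesis
        unfolding rescaled_def seminorm_smul[OF q] mult.assoc
        using that r by (intro mult_mono C) (auto simp: seminorm_nonneg[OF q])
    qed
    then show "\<exists>p\<in>\<Gamma>. \<exists>C\<ge>0. \<forall>s\<in>{0..t}. \<forall>x. q (rescaled c r U s x) \<le> C * p x"
      using p by (intro bexI[of _ p] exI[of _ "exp (cmod c * t) * C"]) auto
  qed
qed

text \<open>
  This is the mean value inequality for the orbit, whose right derivative at \<open>s\<close> is \<open>U s v\<close>.
\<close>

lemma unit_time_estimate:
  assumes q: "q \<in> \<Gamma>" and p: "p \<in> \<Gamma>"
    and C: "\<And>s x. 0 \<le> s \<Longrightarrow> s \<le> 1 \<Longrightarrow> q (U s x) \<le> C * p x"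
    and v: "(difference_quotient smul U x \<longlongrightarrow> v) (at_right 0)"
  shows "q (U 1 x - x) \<le> C * p v"
proof (rule tendsto_le)
  have "filterlim (\<lambda>n. 1 / real n) (at_right 0) sequentially"
  proof (rule tendsto_imp_filterlim_at_right[OF lim_1_over_n])
    show "\<forall>\<^sub>F n in sequentially. 0 < 1 / real n"
      using eventually_gt_at_top[of 0] by eventually_elim simp
  qed
  then have "(\<lambda>n. difference_quotient smul U x (1 / real n)) \<longlonglongrightarrow> v"
    by (rule filterlim_compose[OF v])
  then show "(\<lambda>n. C * p (difference_quotient smul U x (1 / real n))) \<longlonglongrightarrow> C * p v"
    by (intro tendsto_intros tendsto_seminorm[OF p])
  show "\<forall>\<^sub>F n in sequentially. q (U 1 x - x) \<le> C * p (difference_quotient smul U x (1 / real n))"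
    using eventually_gt_at_top[of 0]
  proof eventually_elim
    case (elim n)
    let ?d = "U (1 / n) x - x"
    have "U (real (Suc k) / n) x - U (real k / n) x = U (real k / n) ?d" for k
      using U_plus[of "real k / n" "1 / n" x] by (simp add: U_diff add_divide_distrib add.commute)
    then have "U 1 x - x = (\<Sum>k<n. U (real k / n) ?d)"
      using sum_lessThan_telescope[of "\<lambda>k. U (real k / n) x" n] elim by (simp add: U_0)
    also have "q \<dots> \<le> (\<Sum>k<n. C * p ?d)"
      by (rule order.trans[OF seminorm_sum_le[OF q]], rule sum_mono, rule C) auto
    also have "\<dots> = C * p (difference_quotient smul U x (1 / real n))"
      by (simp add: difference_quotient_def seminorm_smul[OF p])
    finally show ?case .
  qed
qed auto

text \<open>
  The discrete form of \<open>U h y - y = \<integral>\<^sub>0\<^sup>h U s (U 1 x - x) ds\<close> for \<open>y = \<integral>\<^sub>0\<^sup>1 U s x ds\<close>: a shift by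
  \<open>m / n\<close> moves the nodes onto nodes, so that all but \<open>m\<close> summands at either end cancel.
\<close>

lemma U_riemann_mean_orbit:
  assumes n: "0 < n"
  shows "U (real m / n) (riemann_mean (\<lambda>s. U s x) n) - riemann_mean (\<lambda>s. U s x) n =
    smul (1 / of_nat n) (\<Sum>j<m. U (real j / n) (U 1 x - x))"
proof -
  let ?g = "\<lambda>j. U (real j / n) x"
  have shift: "(\<Sum>j<n. g (m + j)) - (\<Sum>j<n. g j) = (\<Sum>j<m. g (n + j) - g j)" for g :: "nat \<Rightarrow> 'a"
  proof (induction m)
    case (Suc m)
    have "g m + (\<Sum>j<n. g (Suc m + j)) = (\<Sum>j<n. g (m + j)) + g (m + n)"
      using sum.lessThan_Suc_shift[of "\<lambda>j. g (m + j)" n] by simp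
    then have "(\<Sum>j<n. g (Suc m + j)) = (\<Sum>j<n. g (m + j)) + g (n + m) - g m"
      by (simp add: eq_diff_eq ac_simps)
    with Suc.IH show ?case by (simp add: algebra_simps)
  qed simp
  have "U (real m / n) (?g j) = ?g (m + j)" for j
    using U_plus[of "real m / n" "real j / n" x] by (simp add: add_divide_distrib)
  then have "U (real m / n) (riemann_mean (\<lambda>s. U s x) n) - riemann_mean (\<lambda>s. U s x) n =
      smul (1 / of_nat n) ((\<Sum>j<n. ?g (m + j)) - (\<Sum>j<n. ?g j))"
    by (simp add: riemann_mean_def U_smul U_sum scale_right_diff_distrib)
  also have "(\<Sum>j<n. ?g (m + j)) - (\<Sum>j<n. ?g j) = (\<Sum>j<m. ?g (n + j) - ?g j)"
    by (rule shift)
  also have "\<dots> = (\<Sum>j<m. U (real j / n) (U 1 x - x))"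
    using n U_plus[of "real _ / n" 1 x]
    by (intro sum.cong refl) (simp add: U_diff add_divide_distrib add.commute)
  finally show ?thesis .
qed

end

section \<open>The Fejer kernel\<close>

definition fourier_mode :: "int \<Rightarrow> real \<Rightarrow> complex" where
  "fourier_mode k s = exp (2 * of_real pi * \<i> * of_int k * of_real s)"

text \<open>
  The square form makes nonnegativity evident; \<open>fejer_kernel_fourier\<close> is the usual trigonometric
  polynomial with triangular coefficients, each frequency \<open>k\<close> occurring for \<open>N - |k|\<close> pairs \<open>(a, b)\<close>.
\<close>

definition fejer_kernel :: "nat \<Rightarrow> real \<Rightarrow> real" where
  "fejer_kernel N s = (cmod (\<Sum>a<N. fourier_mode (int a) s))\<^sup>2 / N"

lemma fejer_kernel_nonneg: "0 \<le> fejer_kernel N s"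
  by (simp add: fejer_kernel_def)

lemma fourier_mode_power: "fourier_mode (int a) s = fourier_mode 1 s ^ a"
  by (simp add: fourier_mode_def mult_ac flip: exp_of_nat_mult)

lemma fejer_kernel_fourier:
  "complex_of_real (fejer_kernel N s) = 1 / of_nat N * (\<Sum>a<N. \<Sum>b<N. fourier_mode (int a - int b) s)"
proof -
  have "fourier_mode (int a - int b) s = fourier_mode (int a) s * cnj (fourier_mode (int b) s)" for a b
    by (simp add: fourier_mode_def exp_cnj algebra_simps flip: exp_add)
  then have "(\<Sum>a<N. \<Sum>b<N. fourier_mode (int a - int b) s) =
      (\<Sum>a<N. fourier_mode (int a) s) * cnj (\<Sum>a<N. fourier_mode (int a) s)"
    by (simp add: sum_product)
  also have "\<dots> = complex_of_real ((cmod (\<Sum>a<N. fourier_mode (int a) s))\<^sup>2)"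
    by (rule complex_norm_square[symmetric])
  finally show ?thesis
    by (simp add: fejer_kernel_def)
qed

text \<open>
  Orthogonality of the characters of \<open>\<int>/n\<int>\<close>: a geometric sum of powers of an \<open>n\<close>-th root of unity
  different from \<open>1\<close>.
\<close>

lemma sum_fourier_mode:
  assumes n: "0 < n" and k: "\<bar>k\<bar> < int n"
  shows "(\<Sum>j<n. fourier_mode k (real j / n)) = (if k = 0 then of_nat n else 0)"
proof (cases "k = 0")
  case True
  then show ?thesis by (simp add: fourier_mode_def)
next
  case False
  let ?z = "fourier_mode k (1 / n)"
  have pow: "fourier_mode k (real j / n) = ?z ^ j" for j
    by (simp add: fourier_mode_def mult_ac flip: exp_of_nat_mult)
  have "?z \<noteq> 1"
  proof
    assume "?z = 1"
    then obtain l :: int where "2 * pi * of_int k / n = of_int (2 * l) * pi"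
      by (auto simp: fourier_mode_def exp_eq_1)
    then have "real_of_int k = real_of_int (l * int n)"
      using n by (simp add: field_simps)
    then have "k = l * int n" by (simp only: of_int_eq_iff)
    then have "int n \<le> \<bar>k\<bar>" using False by (intro zdvd_imp_le) auto
    then show False using k by simp
  qed
  moreover have "?z ^ n = 1"
    using pow[of n] n by (simp add: fourier_mode_def exp_integer_2pi mult_ac)
  ultimately show ?thesis
    using False by (simp add: pow sum_gp_strict)
qed

lemma sum_fejer_kernel:
  assumes N: "0 < N" and n: "N \<le> n"
  shows "(\<Sum>j<n. fejer_kernel N (real j / n)) = n"
proof -
  have "complex_of_real (\<Sum>j<n. fejer_kernel N (real j / n)) =
      1 / of_nat N * (\<Sum>j<n. \<Sum>a<N. \<Sum>b<N. fourier_mode (int a - int b) (real j / n))"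
    by (simp add: fejer_kernel_fourier sum_distrib_left)
  also have "(\<Sum>j<n. \<Sum>a<N. \<Sum>b<N. fourier_mode (int a - int b) (real j / n)) =
      (\<Sum>a<N. \<Sum>b<N. \<Sum>j<n. fourier_mode (int a - int b) (real j / n))"
    by (subst sum.swap) (intro sum.cong refl sum.swap)
  also have "\<dots> = (\<Sum>a<N. \<Sum>b<N. if a = b then of_nat n else 0)"
    using N n by (intro sum.cong refl) (subst sum_fourier_mode, auto)
  also have "\<dots> = of_nat N * of_nat n"
    by simp
  finally have "complex_of_real (\<Sum>j<n. fejer_kernel N (real j / n)) = complex_of_real (real n)"
    using N by simp
  then show ?thesis by (simp only: of_real_eq_iff)
qed

text \<open>
  The geometric sum in the kernel is at most \<open>2 / |1 - fourier_mode 1 s|\<close>, and the denominator is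
  bounded away from \<open>0\<close> by compactness as long as \<open>s\<close> stays away from the integers.
\<close>

lemma fejer_kernel_decay:
  assumes "0 < \<delta>"
  obtains K where "0 \<le> K" "\<And>N s. 0 < N \<Longrightarrow> s \<in> {\<delta>..1 - \<delta>} \<Longrightarrow> fejer_kernel N s \<le> K / N"
proof (cases "\<delta> \<le> 1 - \<delta>")
  case False
  then show thesis by (intro that[of 0]) auto
next
  case True
  have "continuous_on {\<delta>..1 - \<delta>} (\<lambda>s. cmod (1 - fourier_mode 1 s))"
    unfolding fourier_mode_def by (intro continuous_intros)
  then obtain s0 where s0: "s0 \<in> {\<delta>..1 - \<delta>}"
    and min: "\<And>s. s \<in> {\<delta>..1 - \<delta>} \<Longrightarrow> cmod (1 - fourier_mode 1 s0) \<le> cmod (1 - fourier_mode 1 s)"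
    using continuous_attains_inf[of "{\<delta>..1 - \<delta>}"] True by (metis atLeastatMost_empty_iff2 compact_Icc)
  let ?c = "cmod (1 - fourier_mode 1 s0)"
  have "fourier_mode 1 s0 \<noteq> 1"
  proof
    assume "fourier_mode 1 s0 = 1"
    then obtain l :: int where "2 * pi * s0 = of_int (2 * l) * pi"
      by (auto simp: fourier_mode_def exp_eq_1)
    then have "s0 = of_int l" by simp
    then have "0 < real_of_int l" "real_of_int l < 1" using s0 \<open>0 < \<delta>\<close> by auto
    then show False by simp
  qed
  then have c: "0 < ?c" by simp
  show thesis
  proof (rule that[of "(2 / ?c)\<^sup>2"])
    fix N :: nat and s assume N: "0 < N" and s: "s \<in> {\<delta>..1 - \<delta>}"
    let ?z = "fourier_mode 1 s"
    have "cmod ?z = 1" by (simp add: fourier_mode_def)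
    then have "cmod (1 - ?z ^ N) \<le> 2"
      using norm_triangle_ineq4[of 1 "?z ^ N"] by (simp add: norm_power)
    moreover have "cmod (\<Sum>a<N. fourier_mode (int a) s) * cmod (1 - ?z) = cmod (1 - ?z ^ N)"
      by (simp add: fourier_mode_power one_diff_power_eq mult.commute flip: norm_mult)
    ultimately have "cmod (\<Sum>a<N. fourier_mode (int a) s) * ?c \<le> 2"
      using mult_left_mono[OF min[OF s], of "cmod (\<Sum>a<N. fourier_mode (int a) s)"]
      by (smt (verit) norm_ge_zero)
    then have "cmod (\<Sum>a<N. fourier_mode (int a) s) \<le> 2 / ?c"
      using c by (simp add: field_simps)
    then show "fejer_kernel N s \<le> (2 / ?c)\<^sup>2 / N"
      unfolding fejer_kernel_def by (intro divide_right_mono power_mono) auto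
  qed simp
qed

context locally_convex_space
begin

lemma riemann_mean_smul: "riemann_mean (\<lambda>s. smul c (f s)) n = smul c (riemann_mean f n)"
  by (simp add: riemann_mean_def mult.commute flip: scale_sum_right)

lemma riemann_mean_sum: "riemann_mean (\<lambda>s. \<Sum>i\<in>I. f i s) n = (\<Sum>i\<in>I. riemann_mean (f i) n)"
  unfolding riemann_mean_def by (subst sum.swap) (simp add: scale_sum_right)

text \<open>
  Fejer's argument, for a function that stays near \<open>x\<close> at both ends of the unit interval; the double
  sum is its Fejer mean at \<open>0\<close>, written with Fourier coefficients. The kernel has mean \<open>1\<close>, so \<open>x\<close> may be
  moved under the mean. Then the ends contribute at most \<open>\<epsilon>\<close> because the kernel is nonnegative, and the
  middle at most \<open>M * \<eta>\<close> because the kernel is small there.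
\<close>

lemma fejer_approximation:
  assumes q: "q \<in> \<Gamma>" and N: "0 < N" and "0 \<le> M" "0 \<le> \<epsilon>"
    and y: "\<And>k. riemann_mean (\<lambda>s. smul (fourier_mode k s) (f s)) \<longlonglongrightarrow> y k"
    and bounded: "\<And>s. s \<in> {0..1} \<Longrightarrow> q (f s - x) \<le> M"
    and near: "\<And>s. s \<in> {0..1} \<Longrightarrow> s < \<delta> \<or> 1 - \<delta> < s \<Longrightarrow> q (f s - x) \<le> \<epsilon>"
    and decay: "\<And>s. s \<in> {\<delta>..1 - \<delta>} \<Longrightarrow> fejer_kernel N s \<le> \<eta>" and "0 \<le> \<eta>"
  shows "q (smul (1 / of_nat N) (\<Sum>a<N. \<Sum>b<N. y (int a - int b)) - x) \<le> \<epsilon> + M * \<eta>"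
proof (rule tendsto_upperbound)
  let ?g = "\<lambda>s. smul (of_real (fejer_kernel N s)) (f s)"
  have "?g = (\<lambda>s. smul (1 / of_nat N) (\<Sum>a<N. \<Sum>b<N. smul (fourier_mode (int a - int b) s) (f s)))"
    by (simp only: fejer_kernel_fourier scale_sum_left flip: scale_scale)
  then have eq: "riemann_mean ?g n = smul (1 / of_nat N)
      (\<Sum>a<N. \<Sum>b<N. riemann_mean (\<lambda>s. smul (fourier_mode (int a - int b) s) (f s)) n)" for n
    by (simp only: riemann_mean_smul riemann_mean_sum)
  have "(\<lambda>n. riemann_mean ?g n) \<longlonglongrightarrow> smul (1 / of_nat N) (\<Sum>a<N. \<Sum>b<N. y (int a - int b))"
    unfolding eq by (intro tendsto_smul tendsto_const tendsto_sum y)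
  then show "(\<lambda>n. q (riemann_mean ?g n - x)) \<longlonglongrightarrow>
      q (smul (1 / of_nat N) (\<Sum>a<N. \<Sum>b<N. y (int a - int b)) - x)"
    by (intro tendsto_seminorm[OF q] tendsto_diff tendsto_const)
  show "\<forall>\<^sub>F n in sequentially. q (riemann_mean ?g n - x) \<le> \<epsilon> + M * \<eta>"
    using eventually_ge_at_top[of N]
  proof eventually_elim
    case (elim n)
    then have n: "0 < n" using N by simp
    let ?F = "\<lambda>j. fejer_kernel N (real j / n)"
    have "(\<Sum>j<n. smul (of_real (?F j)) x) = smul (of_nat n) x"
      using sum_fejer_kernel[OF N elim] by (simp flip: scale_sum_left of_real_sum)
    then have "x = smul (1 / of_nat n) (\<Sum>j<n. smul (of_real (?F j)) x)"
      using n by simp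
    then have "riemann_mean ?g n - x =
        smul (1 / of_nat n) (\<Sum>j<n. smul (of_real (?F j)) (f (real j / n)) - smul (of_real (?F j)) x)"
      by (simp add: riemann_mean_def sum_subtractf scale_right_diff_distrib)
    then have "riemann_mean ?g n - x = smul (1 / of_nat n) (\<Sum>j<n. smul (of_real (?F j)) (f (real j / n) - x))"
      by (simp only: scale_right_diff_distrib)
    then have "q (riemann_mean ?g n - x) = q (\<Sum>j<n. smul (of_real (?F j)) (f (real j / n) - x)) / n"
      by (simp add: seminorm_smul[OF q] norm_divide)
    also have "q (\<Sum>j<n. smul (of_real (?F j)) (f (real j / n) - x)) \<le> (\<Sum>j<n. ?F j * \<epsilon> + M * \<eta>)"
    proof (rule order.trans[OF seminorm_sum_le[OF q]], rule sum_mono)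
      fix j assume "j \<in> {..<n}"
      then have s: "real j / n \<in> {0..1}" by auto
      have "?F j * q (f (real j / n) - x) \<le> ?F j * \<epsilon> + M * \<eta>"
      proof (cases "real j / n \<in> {\<delta>..1 - \<delta>}")
        case True
        then have "?F j * q (f (real j / n) - x) \<le> \<eta> * M"
          using bounded[OF s] \<open>0 \<le> \<eta>\<close> by (intro mult_mono decay) (auto simp: seminorm_nonneg[OF q])
        then show ?thesis
          using fejer_kernel_nonneg[of N "real j / n"] \<open>0 \<le> \<epsilon>\<close> by (simp add: mult.commute add_increasing)
      next
        case False
        then have "?F j * q (f (real j / n) - x) \<le> ?F j * \<epsilon>"
          using near[OF s] by (intro mult_left_mono fejer_kernel_nonneg) auto
        then show ?thesis using \<open>0 \<le> M\<close> \<open>0 \<le> \<eta>\<close> by (simp add: add_increasing2)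
      qed
      then show "q (smul (of_real (?F j)) (f (real j / n) - x)) \<le> ?F j * \<epsilon> + M * \<eta>"
        by (simp add: seminorm_smul[OF q] fejer_kernel_nonneg)
    qed
    also have "(\<Sum>j<n. ?F j * \<epsilon> + M * \<eta>) = n * (\<epsilon> + M * \<eta>)"
      using sum_fejer_kernel[OF N elim] by (simp add: sum.distrib distrib_left flip: sum_distrib_right)
    finally show ?case using n by (simp add: divide_right_mono)
  qed
qed simp

end

section \<open>Averages of orbits lie in the domain of the generator\<close>

context equicontinuous_semigroup
begin

lemma continuous_at_orbit:
  assumes "0 \<le> h" and "\<And>n. 0 \<le> s n" and "s \<longlonglongrightarrow> h"
  shows "(\<lambda>n. U (s n) x) \<longlonglongrightarrow> U h x"
  using continuous_on_tendsto_compose[OF continuous_orbit, of s h sequentially x] assms by simp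

text \<open>
  The limit of \<open>U_riemann_mean_orbit\<close> with \<open>m / n \<rightarrow> h\<close>. Since the right-hand side there consists of
  about \<open>n h\<close> summands close to \<open>U 1 x - x\<close>, the increment of \<open>y\<close> is close to \<open>h (U 1 x - x)\<close>.
\<close>

lemma riemann_mean_orbit_increment:
  assumes y: "riemann_mean (\<lambda>s. U s x) \<longlonglongrightarrow> y"
    and q: "q \<in> \<Gamma>" and h: "0 \<le> h" "h \<le> 1" and "0 \<le> \<epsilon>"
    and near: "\<And>s. 0 \<le> s \<Longrightarrow> s \<le> h \<Longrightarrow> q (U s (U 1 x - x) - (U 1 x - x)) \<le> \<epsilon>"
  shows "q (U h y - y - smul (of_real h) (U 1 x - x)) \<le> h * \<epsilon>"
proof (rule tendsto_upperbound)
  let ?z = "U 1 x - x" and ?R = "riemann_mean (\<lambda>s. U s x)"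
  define m where "m n = nat \<lfloor>real n * h\<rfloor>" for n
  have m_le: "real (m n) / n \<le> h" for n
  proof (cases "n = 0")
    case False
    then show ?thesis using h by (simp add: m_def divide_simps mult.commute)
  qed (use h in simp)
  have m_ge: "h - 1 / n \<le> real (m n) / n" if "0 < n" for n
  proof -
    have "real n * h - 1 \<le> real (m n)" using h unfolding m_def by linarith
    then have "(real n * h - 1) / n \<le> real (m n) / n" by (rule divide_right_mono) simp
    then show ?thesis using that by (simp add: diff_divide_distrib)
  qed
  have m_lim: "(\<lambda>n. real (m n) / n) \<longlonglongrightarrow> h"
  proof (rule tendsto_sandwich)
    have "(\<lambda>n. h - 1 / real n) \<longlonglongrightarrow> h - 0"
      by (intro tendsto_intros lim_1_over_n)
    then show "(\<lambda>n. h - 1 / real n) \<longlonglongrightarrow> h" by simp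
    show "\<forall>\<^sub>F n in sequentially. h - 1 / real n \<le> real (m n) / n"
      using eventually_gt_at_top[of 0] by eventually_elim (rule m_ge)
    show "\<forall>\<^sub>F n in sequentially. real (m n) / n \<le> h" by (simp add: m_le)
    show "(\<lambda>n. h) \<longlonglongrightarrow> h" by simp
  qed
  have R: "(\<lambda>n. ?R n - y) \<longlonglongrightarrow> 0"
    using tendsto_diff[OF y tendsto_const[of y]] by simp
  \<comment> \<open>Time and vector vary simultaneously; equicontinuity on \<open>[0, h]\<close> takes care of the vector.\<close>
  have "(\<lambda>n. U (real (m n) / n) (?R n - y)) \<longlonglongrightarrow> 0"
    unfolding tendsto_iff_seminorms
  proof
    fix q assume q: "q \<in> \<Gamma>"
    show "(\<lambda>n. q (U (real (m n) / n) (?R n - y) - 0)) \<longlonglongrightarrow> 0"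
    proof (rule tendstoI)
      fix \<epsilon> :: real assume "0 < \<epsilon>"
      with tendsto_zero_U[OF _ R q, of h] h
      have "\<forall>\<^sub>F n in sequentially. \<forall>s\<in>{0..h}. q (U s (?R n - y)) < \<epsilon>" by simp
      then show "\<forall>\<^sub>F n in sequentially. dist (q (U (real (m n) / n) (?R n - y) - 0)) 0 < \<epsilon>"
        by eventually_elim (simp add: m_le seminorm_nonneg[OF q])
    qed
  qed
  moreover have "(\<lambda>n. U (real (m n) / n) y) \<longlonglongrightarrow> U h y"
    using h by (intro continuous_at_orbit m_lim) auto
  ultimately have "(\<lambda>n. U (real (m n) / n) (?R n - y) + U (real (m n) / n) y) \<longlonglongrightarrow> 0 + U h y"
    by (rule tendsto_add)
  then have "(\<lambda>n. U (real (m n) / n) (?R n)) \<longlonglongrightarrow> U h y"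
    by (simp add: U_diff)
  moreover have "(\<lambda>n. smul (of_real (real (m n) / n)) ?z) \<longlonglongrightarrow> smul (of_real h) ?z"
    by (intro tendsto_smul tendsto_of_real m_lim tendsto_const)
  ultimately show "(\<lambda>n. q (U (real (m n) / n) (?R n) - ?R n - smul (of_real (real (m n) / n)) ?z))
      \<longlonglongrightarrow> q (U h y - y - smul (of_real h) ?z)"
    by (intro tendsto_seminorm[OF q] tendsto_diff y)
  show "\<forall>\<^sub>F n in sequentially.
      q (U (real (m n) / n) (?R n) - ?R n - smul (of_real (real (m n) / n)) ?z) \<le> h * \<epsilon>"
    using eventually_gt_at_top[of 0]
  proof eventually_elim
    case (elim n)
    have "U (real (m n) / n) (?R n) - ?R n - smul (of_real (real (m n) / n)) ?z =
        smul (1 / of_nat n) (\<Sum>j<m n. U (real j / n) ?z - ?z)"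
      using elim by (simp add: U_riemann_mean_orbit sum_subtractf sum_constant_smul scale_right_diff_distrib)
    also have "q \<dots> = q (\<Sum>j<m n. U (real j / n) ?z - ?z) / n"
      by (simp add: seminorm_smul[OF q] norm_divide)
    also have "\<dots> \<le> (\<Sum>j<m n. \<epsilon>) / n"
    proof (intro divide_right_mono, rule order.trans[OF seminorm_sum_le[OF q]], rule sum_mono, rule near)
      fix j assume "j \<in> {..<m n}"
      then have "real j / n \<le> real (m n) / n" by (intro divide_right_mono) auto
      then show "real j / n \<le> h" using m_le[of n] by linarith
    qed auto
    also have "\<dots> = real (m n) / n * \<epsilon>" by simp
    also have "\<dots> \<le> h * \<epsilon>" using m_le \<open>0 \<le> \<epsilon>\<close> by (rule mult_right_mono)
    finally show ?case .
  qed
qed simp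

lemma difference_quotient_riemann_mean:
  assumes y: "riemann_mean (\<lambda>s. U s x) \<longlonglongrightarrow> y"
  shows "(difference_quotient smul U y \<longlongrightarrow> U 1 x - x) (at_right 0)"
  unfolding tendsto_iff_seminorms
proof
  let ?z = "U 1 x - x"
  fix q assume q: "q \<in> \<Gamma>"
  show "((\<lambda>h. q (difference_quotient smul U y h - ?z)) \<longlongrightarrow> 0) (at_right 0)"
  proof (rule tendstoI)
    fix \<epsilon> :: real assume "0 < \<epsilon>"
    have "((\<lambda>s. U s ?z) \<longlongrightarrow> U 0 ?z) (at 0 within {0..})"
      using continuous_orbit[of ?z] by (simp add: continuous_on_def)
    then have "((\<lambda>s. q (U s ?z - ?z)) \<longlongrightarrow> 0) (at 0 within {0..})"
      using q by (simp add: tendsto_iff_seminorms U_0)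
    then have "\<forall>\<^sub>F s in at 0 within {0..}. q (U s ?z - ?z) < \<epsilon> / 2"
      by (rule order_tendstoD(2)) (use \<open>0 < \<epsilon>\<close> in simp)
    then obtain d where d: "0 < d"
      and near: "\<And>s. 0 < s \<Longrightarrow> s < d \<Longrightarrow> q (U s ?z - ?z) < \<epsilon> / 2"
      unfolding eventually_at by (auto simp: dist_real_def)
    have "\<forall>\<^sub>F h in at_right 0. h < min d (1::real)"
      using d by (intro order_tendstoD(2)[OF tendsto_ident_at]) auto
    with eventually_at_right_less[of "0::real"]
    show "\<forall>\<^sub>F h in at_right 0. dist (q (difference_quotient smul U y h - ?z)) 0 < \<epsilon>"
    proof eventually_elim
      case (elim h)
      have "q (U s ?z - ?z) \<le> \<epsilon> / 2" if "0 \<le> s" "s \<le> h" for s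
        using near[of s] that elim \<open>0 < \<epsilon>\<close> by (cases "s = 0") (auto simp: U_0 seminorm_zero[OF q])
      then have le: "q (U h y - y - smul (of_real h) ?z) \<le> h * (\<epsilon> / 2)"
        using elim \<open>0 < \<epsilon>\<close> by (intro riemann_mean_orbit_increment[OF y q]) auto
      have "difference_quotient smul U y h - ?z = smul (of_real (1 / h)) (U h y - y - smul (of_real h) ?z)"
        using elim by (simp add: difference_quotient_def scale_right_diff_distrib)
      then have "q (difference_quotient smul U y h - ?z) = q (U h y - y - smul (of_real h) ?z) / h"
        using elim by (simp add: seminorm_smul[OF q] norm_divide)
      also have "\<dots> \<le> \<epsilon> / 2" using le elim by (simp add: divide_simps mult.commute)
      finally show ?case using \<open>0 < \<epsilon>\<close> by (simp add: seminorm_nonneg[OF q])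
    qed
  qed
qed

end

section \<open>Fourier coefficients detect null sequences\<close>

context equicontinuous_semigroup
begin

lemma iterates_tendsto_zero:
  assumes z: "(\<lambda>i. U 1 (x i) - x i) \<longlonglongrightarrow> 0"
  shows "(\<lambda>i. U (real n) (x i) - x i) \<longlonglongrightarrow> 0"
proof (induction n)
  case (Suc n)
  have "(\<lambda>i. U n (U 1 (x i) - x i)) \<longlonglongrightarrow> 0"
    unfolding tendsto_iff_seminorms
  proof
    fix q assume q: "q \<in> \<Gamma>"
    show "(\<lambda>i. q (U n (U 1 (x i) - x i) - 0)) \<longlonglongrightarrow> 0"
    proof (rule tendstoI)
      fix \<epsilon> :: real assume "0 < \<epsilon>"
      from tendsto_zero_U[OF _ z q this, of n]
      show "\<forall>\<^sub>F i in sequentially. dist (q (U n (U 1 (x i) - x i) - 0)) 0 < \<epsilon>"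
        by (auto elim!: eventually_mono simp: seminorm_nonneg[OF q])
    qed
  qed
  from tendsto_add[OF this Suc.IH] show ?case
    using U_plus[of "real n" 1] by (simp add: U_diff add.commute)
qed (simp add: U_0)

end

context locally_convex_space
begin

text \<open>
  Continuity of \<open>T\<close> on \<open>[\<tau>, \<infinity>)\<close> for uniform convergence on bounded sets, unfolded to pointwise
  estimates; see \<open>Lb_continuous_fromI\<close>.
\<close>

definition Lb_continuous_from :: "real \<Rightarrow> (real \<Rightarrow> 'a \<Rightarrow> 'a) \<Rightarrow> bool" where
  "Lb_continuous_from \<tau> T \<longleftrightarrow>
     (\<forall>s\<ge>\<tau>. \<forall>q\<in>\<Gamma>. \<forall>B. lcs_bounded \<Gamma> B \<longrightarrow> (\<forall>\<epsilon>>0. \<exists>\<delta>>0. \<forall>s'\<ge>\<tau>. \<bar>s' - s\<bar> < \<delta> \<longrightarrow>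
        (\<forall>x\<in>B. q (T s' x - T s x) < \<epsilon>)))"

lemma Lb_continuous_fromE:
  assumes "Lb_continuous_from \<tau> T" "\<tau> \<le> s" "q \<in> \<Gamma>" "lcs_bounded \<Gamma> B" "0 < \<epsilon>"
  obtains \<delta> where "0 < \<delta>"
    "\<And>s' x. \<tau> \<le> s' \<Longrightarrow> \<bar>s' - s\<bar> < \<delta> \<Longrightarrow> x \<in> B \<Longrightarrow> q (T s' x - T s x) < \<epsilon>"
proof -
  have "\<exists>\<delta>>0. \<forall>s'\<ge>\<tau>. \<bar>s' - s\<bar> < \<delta> \<longrightarrow> (\<forall>x\<in>B. q (T s' x - T s x) < \<epsilon>)"
    using assms unfolding Lb_continuous_from_def by simp
  then show thesis using that by metis
qed

lemma lcs_boundedI: "(\<And>q. q \<in> \<Gamma> \<Longrightarrow> \<exists>M. \<forall>x\<in>B. q x \<le> M) \<Longrightarrow> lcs_bounded \<Gamma> B"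
  unfolding lcs_bounded_def bdd_above_def by auto

lemma lcs_boundedE:
  assumes "lcs_bounded \<Gamma> B" "q \<in> \<Gamma>"
  obtains M where "0 < M" "\<And>x. x \<in> B \<Longrightarrow> q x \<le> M"
proof -
  obtain M where "\<forall>x\<in>B. q x \<le> M"
    using assms unfolding lcs_bounded_def bdd_above_def by auto
  then show thesis by (intro that[of "max M 1"]) (auto intro: le_max_iff_disj[THEN iffD2])
qed

end

context equicontinuous_semigroup
begin

text \<open>
  For fixed \<open>n \<ge> \<tau>\<close> and large \<open>i\<close>, \<open>U s (x i)\<close> is close to \<open>U (s + n) (x i)\<close>, while \<open>U n (x i)\<close> and
  \<open>U (n + 1) (x i)\<close> are both close to \<open>x i\<close>. Continuity of \<open>U\<close> on bounded sets at the two times \<open>n\<close> and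
  \<open>n + 1\<close> thus controls \<open>s\<close> near \<open>0\<close> and \<open>s\<close> near \<open>1\<close>.
\<close>

lemma almost_periodic_near_zero:
  assumes U: "Lb_continuous_from \<tau> U"
    and bounded: "lcs_bounded \<Gamma> (range x)"
    and z: "(\<lambda>i. U 1 (x i) - x i) \<longlonglongrightarrow> 0"
    and q: "q \<in> \<Gamma>" and "0 < \<epsilon>"
  obtains \<delta> where "0 < \<delta>"
    "\<forall>\<^sub>F i in sequentially. \<forall>s\<in>{0..1}. s < \<delta> \<or> 1 - \<delta> < s \<longrightarrow> q (U s (x i) - x i) < \<epsilon>"
proof -
  obtain n :: nat where n: "\<tau> \<le> n" using real_arch_simple by blast
  have e: "0 < \<epsilon> / 3" using \<open>0 < \<epsilon>\<close> by simp
  obtain \<delta>1 where d1: "0 < \<delta>1"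
    "\<And>s' v. \<tau> \<le> s' \<Longrightarrow> \<bar>s' - n\<bar> < \<delta>1 \<Longrightarrow> v \<in> range x \<Longrightarrow> q (U s' v - U n v) < \<epsilon> / 3"
    using Lb_continuous_fromE[OF U n q bounded e] by blast
  have n': "\<tau> \<le> real (Suc n)" using n by simp
  obtain \<delta>2 where d2: "0 < \<delta>2"
    "\<And>s' v. \<tau> \<le> s' \<Longrightarrow> \<bar>s' - real (Suc n)\<bar> < \<delta>2 \<Longrightarrow> v \<in> range x \<Longrightarrow> q (U s' v - U (real (Suc n)) v) < \<epsilon> / 3"
    using Lb_continuous_fromE[OF U n' q bounded e] by blast
  have near: "\<exists>m\<in>{n, Suc n}. q (U (s + n) (x i) - U (real m) (x i)) < \<epsilon> / 3"
    if "s \<in> {0..1}" "s < min \<delta>1 \<delta>2 \<or> 1 - min \<delta>1 \<delta>2 < s" for s i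
  proof (cases "s < min \<delta>1 \<delta>2")
    case True
    then have "\<bar>s + n - real n\<bar> < \<delta>1" using that by auto
    then show ?thesis using d1(2)[of "s + n" "x i"] that n by auto
  next
    case False
    then have "\<bar>s + n - real (Suc n)\<bar> < \<delta>2" using that by auto
    then show ?thesis using d2(2)[of "s + n" "x i"] that n by auto
  qed
  show thesis
  proof (rule that[of "min \<delta>1 \<delta>2"])
    have tail: "\<forall>\<^sub>F i in sequentially. q (U (real m) (x i) - x i) < \<epsilon> / 3" for m
    proof -
      have "(\<lambda>i. q (U (real m) (x i) - x i)) \<longlonglongrightarrow> 0"
        using iterates_tendsto_zero[OF z, of m] q by (simp add: tendsto_iff_seminorms)
      then show ?thesis using e by (rule order_tendstoD(2))
    qed
    have "\<forall>\<^sub>F i in sequentially. \<forall>s\<in>{0..1}. q (U s (U (real n) (x i) - x i)) < \<epsilon> / 3"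
      by (rule tendsto_zero_U[OF _ iterates_tendsto_zero[OF z] q e]) simp
    with tail[of n] tail[of "Suc n"]
    show "\<forall>\<^sub>F i in sequentially. \<forall>s\<in>{0..1}. s < min \<delta>1 \<delta>2 \<or> 1 - min \<delta>1 \<delta>2 < s \<longrightarrow>
        q (U s (x i) - x i) < \<epsilon>"
    proof eventually_elim
      case (elim i)
      show ?case
      proof (intro ballI impI)
        fix s assume s: "s \<in> {0..1}" "s < min \<delta>1 \<delta>2 \<or> 1 - min \<delta>1 \<delta>2 < s"
        obtain m where m: "m \<in> {n, Suc n}" "q (U (s + n) (x i) - U (real m) (x i)) < \<epsilon> / 3"
          using near[OF s] by blast
        have tail_m: "q (U (real m) (x i) - x i) < \<epsilon> / 3" using m(1) elim by auto
        have "U (s + n) (x i) - U s (x i) = U s (U (real n) (x i) - x i)"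
          using s by (simp add: U_plus U_diff)
        then have "q (U s (x i) - U (s + n) (x i)) < \<epsilon> / 3"
          using elim s seminorm_diff_commute[OF q, of "U s (x i)"] by simp
        then show "q (U s (x i) - x i) < \<epsilon>"
          using m(2) tail_m seminorm_diff_triangle[OF q, of "U s (x i)" "x i" "U (s + n) (x i)"]
            seminorm_diff_triangle[OF q, of "U (s + n) (x i)" "x i" "U (real m) (x i)"] by linarith
      qed
    qed
  qed (use d1 d2 in auto)
qed

text \<open>
  The Fejer mean \<open>Y i\<close> of the orbit of \<open>x i\<close> is within \<open>2 \<epsilon> / 3\<close> of \<open>x i\<close> for large \<open>i\<close>, with an order \<open>N\<close>
  that does not depend on \<open>i\<close>; and \<open>Y i\<close> is a fixed linear combination of finitely many coefficients.
\<close>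

lemma tendsto_zero_if_fourier_coefficients:
  assumes U: "Lb_continuous_from \<tau> U"
    and bounded: "lcs_bounded \<Gamma> (range x)"
    and z: "(\<lambda>i. U 1 (x i) - x i) \<longlonglongrightarrow> 0"
    and y: "\<And>k i. riemann_mean (\<lambda>s. smul (fourier_mode k s) (U s (x i))) \<longlonglongrightarrow> y k i"
    and coefficients: "\<And>k. y k \<longlonglongrightarrow> 0"
  shows "x \<longlonglongrightarrow> 0"
  unfolding tendsto_iff_seminorms
proof
  fix q assume q: "q \<in> \<Gamma>"
  obtain p C where p: "p \<in> \<Gamma>" and "0 \<le> C"
    and C: "\<And>s v. 0 \<le> s \<Longrightarrow> s \<le> 1 \<Longrightarrow> q (U s v) \<le> C * p v"
    using equicontinuousE[OF q, of 1] by auto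
  obtain M1 where M1: "0 < M1" "\<And>v. v \<in> range x \<Longrightarrow> p v \<le> M1" using lcs_boundedE[OF bounded p] by blast
  obtain M2 where M2: "0 < M2" "\<And>v. v \<in> range x \<Longrightarrow> q v \<le> M2" using lcs_boundedE[OF bounded q] by blast
  define M where "M = C * M1 + M2"
  have "0 < M" using M1(1) M2(1) \<open>0 \<le> C\<close> by (simp add: M_def add_nonneg_pos)
  have M: "q (U s (x i) - x i) \<le> M" if "s \<in> {0..1}" for s i
  proof -
    have "q (U s (x i)) \<le> C * p (x i)" using C that by simp
    also have "\<dots> \<le> C * M1" using M1(2) \<open>0 \<le> C\<close> by (intro mult_left_mono) auto
    finally show ?thesis
      using M2(2)[of "x i"] seminorm_diff_le[OF q, of "U s (x i)" "x i"] by (simp add: M_def)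
  qed
  show "(\<lambda>i. q (x i - 0)) \<longlonglongrightarrow> 0"
  proof (rule tendstoI)
    fix \<epsilon> :: real assume "0 < \<epsilon>"
    then have e: "0 < \<epsilon> / 3" by simp
    obtain \<delta> where "0 < \<delta>" and near:
      "\<forall>\<^sub>F i in sequentially. \<forall>s\<in>{0..1}. s < \<delta> \<or> 1 - \<delta> < s \<longrightarrow> q (U s (x i) - x i) < \<epsilon> / 3"
      using almost_periodic_near_zero[OF U bounded z q e] .
    obtain K where "0 \<le> K"
      and K: "\<And>N s. 0 < N \<Longrightarrow> s \<in> {\<delta>..1 - \<delta>} \<Longrightarrow> fejer_kernel N s \<le> K / N"
      using fejer_kernel_decay[OF \<open>0 < \<delta>\<close>] by blast
    obtain N :: nat where N: "3 * M * K / \<epsilon> < N" using reals_Archimedean2 by blast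
    have "0 \<le> 3 * M * K / \<epsilon>" using \<open>0 < M\<close> \<open>0 \<le> K\<close> \<open>0 < \<epsilon>\<close> by simp
    then have "0 < N" using N by linarith
    have small: "M * (K / N) < \<epsilon> / 3" using N \<open>0 < N\<close> \<open>0 < \<epsilon>\<close> by (simp add: field_simps)
    define Y where "Y i = smul (1 / of_nat N) (\<Sum>a<N. \<Sum>b<N. y (int a - int b) i)" for i
    have "Y \<longlonglongrightarrow> smul (1 / of_nat N) (\<Sum>a<N. \<Sum>b<N. 0)"
      unfolding Y_def by (intro tendsto_smul tendsto_const tendsto_sum coefficients)
    then have "(\<lambda>i. q (Y i)) \<longlonglongrightarrow> 0"
      using q by (simp add: tendsto_iff_seminorms)
    then have "\<forall>\<^sub>F i in sequentially. q (Y i) < \<epsilon> / 3"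
      by (rule order_tendstoD(2)) (rule e)
    with near show "\<forall>\<^sub>F i in sequentially. dist (q (x i - 0)) 0 < \<epsilon>"
    proof eventually_elim
      case (elim i)
      have "q (Y i - x i) \<le> \<epsilon> / 3 + M * (K / N)"
        unfolding Y_def
        by (rule fejer_approximation[OF q \<open>0 < N\<close> _ _ y M _ K[OF \<open>0 < N\<close>]])
          (use elim(1) \<open>0 < M\<close> e \<open>0 \<le> K\<close> in \<open>auto intro: less_imp_le\<close>)
      moreover have "q (x i) \<le> q (Y i) + q (Y i - x i)"
        using seminorm_diff_le[OF q, of "Y i" "Y i - x i"] by simp
      ultimately have "q (x i) < \<epsilon>" using elim(2) small by linarith
      then show ?case by (simp add: seminorm_nonneg[OF q])
    qed
  qed
qed

end

section \<open>Continuity for uniform convergence on bounded sets\<close>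

context equicontinuous_semigroup
begin

lemma Lb_continuous_fromI:
  assumes "0 \<le> \<tau>" and U: "continuous_map (top_of_set {\<tau>..}) (Lb_topology smul \<Gamma>) U"
  shows "Lb_continuous_from \<tau> U"
  unfolding Lb_continuous_from_def
proof (intro allI ballI impI)
  fix s q B and \<epsilon> :: real
  assume s: "\<tau> \<le> s" and q: "q \<in> \<Gamma>" and B: "lcs_bounded \<Gamma> B" and "0 < \<epsilon>"
  show "\<exists>\<delta>>0. \<forall>s'\<ge>\<tau>. \<bar>s' - s\<bar> < \<delta> \<longrightarrow> (\<forall>x\<in>B. q (U s' x - U s x) < \<epsilon>)"
  proof (cases "B = {}")
    case True
    then show ?thesis by (auto intro: exI[of _ 1])
  next
    case False
    have U_in: "U s' \<in> cont_linear_ops smul" if "\<tau> \<le> s'" for s'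
      using semigroup \<open>0 \<le> \<tau>\<close> that by (simp add: op_semigroup_def)
    let ?N = "{R \<in> cont_linear_ops smul. (SUP x\<in>B. q (R x - U s x)) < \<epsilon>}"
    have "openin (Lb_topology smul \<Gamma>) ?N"
      unfolding Lb_topology_def
      by (rule topology_generated_by_Basis) (use U_in[OF s] B False q \<open>0 < \<epsilon>\<close> in blast)
    then have "openin (top_of_set {\<tau>..}) {s' \<in> topspace (top_of_set {\<tau>..}). U s' \<in> ?N}"
      by (rule openin_continuous_map_preimage[OF U])
    moreover define P where "P = {s' \<in> {\<tau>..}. U s' \<in> ?N}"
    ultimately have "openin (top_of_set {\<tau>..}) P" by simp
    moreover have "s \<in> P"
      using s U_in False \<open>0 < \<epsilon>\<close> by (simp add: P_def seminorm_zero[OF q])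
    ultimately obtain \<delta> where "0 < \<delta>" and \<delta>: "\<And>s'. \<tau> \<le> s' \<Longrightarrow> dist s' s < \<delta> \<Longrightarrow> s' \<in> P"
      unfolding openin_euclidean_subtopology_iff by (meson atLeast_iff)
    have "q (U s' x - U s x) < \<epsilon>" if s': "\<tau> \<le> s'" "\<bar>s' - s\<bar> < \<delta>" and x: "x \<in> B" for s' x
    proof -
      \<comment> \<open>To pass from the supremum to single vectors, the values must be bounded above: the supremum of an
        unbounded set is unspecified.\<close>
      obtain p C where p: "p \<in> \<Gamma>" and "0 \<le> C"
        and C: "\<And>r x. 0 \<le> r \<Longrightarrow> r \<le> max s s' \<Longrightarrow> q (U r x) \<le> C * p x"
        using equicontinuousE[OF q, of "max s s'"] s \<open>0 \<le> \<tau>\<close> by (auto simp: le_max_iff_disj)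
      obtain M where M: "\<And>x. x \<in> B \<Longrightarrow> p x \<le> M" using lcs_boundedE[OF B p] by blast
      have "q (U s' x - U s x) \<le> C * M + C * M" if "x \<in> B" for x
      proof -
        have "q (U r x) \<le> C * M" if "r = s \<or> r = s'" for r
          using C[of r x] mult_left_mono[OF M[OF \<open>x \<in> B\<close>] \<open>0 \<le> C\<close>] that s s' \<open>0 \<le> \<tau>\<close> by auto
        from this[of s] this[of s'] show ?thesis
          using seminorm_diff_le[OF q, of "U s' x" "U s x"] by simp
      qed
      then have "bdd_above ((\<lambda>x. q (U s' x - U s x)) ` B)" by (intro bdd_aboveI2) auto
      then have "q (U s' x - U s x) \<le> (SUP x\<in>B. q (U s' x - U s x))"
        using x by (rule cSUP_upper[rotated])
      also have "\<dots> < \<epsilon>" using \<delta>[of s'] s' by (simp add: P_def dist_real_def)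
      finally show ?thesis .
    qed
    then show ?thesis using \<open>0 < \<delta>\<close> by auto
  qed
qed

lemma Lb_continuous_from_rescaled:
  assumes U: "Lb_continuous_from \<tau> U" and "0 \<le> \<tau>" and r: "0 < r"
  shows "Lb_continuous_from (\<tau> / r) (rescaled c r U)"
  unfolding Lb_continuous_from_def
proof (intro allI ballI impI)
  fix s q B and \<epsilon> :: real
  assume s: "\<tau> / r \<le> s" and q: "q \<in> \<Gamma>" and B: "lcs_bounded \<Gamma> B" and "0 < \<epsilon>"
  have rs: "\<tau> \<le> r * s" using s r by (simp add: divide_simps mult.commute)
  let ?e = "\<lambda>s. exp (c * complex_of_real s)"
  define L where "L = cmod (?e s) + 1"
  have "0 < L" by (simp add: L_def add_nonneg_pos)
  obtain p C where p: "p \<in> \<Gamma>" and "0 \<le> C" and C: "\<And>x. q (U (r * s) x) \<le> C * p x"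
    using equicontinuousE[OF q, of "r * s"] rs \<open>0 \<le> \<tau>\<close> by (metis order.trans order_refl)
  obtain M where "0 < M" and M: "\<And>x. x \<in> B \<Longrightarrow> p x \<le> M" using lcs_boundedE[OF B p] by blast
  define K where "K = C * M + 1"
  have "0 < K" using \<open>0 \<le> C\<close> \<open>0 < M\<close> by (simp add: K_def add_nonneg_pos)
  have K: "q (U (r * s) x) \<le> K" if "x \<in> B" for x
    using C[of x] mult_left_mono[OF M[OF that] \<open>0 \<le> C\<close>] by (simp add: K_def)
  have "0 < \<epsilon> / (2 * L)" using \<open>0 < \<epsilon>\<close> \<open>0 < L\<close> by simp
  then obtain d1 where "0 < d1"
    and d1: "\<And>s' x. \<tau> \<le> s' \<Longrightarrow> \<bar>s' - r * s\<bar> < d1 \<Longrightarrow> x \<in> B \<Longrightarrow> q (U s' x - U (r * s) x) < \<epsilon> / (2 * L)"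
    using Lb_continuous_fromE[OF U rs q B] by blast
  have "isCont ?e s" by (intro continuous_intros)
  moreover have "0 < min 1 (\<epsilon> / (2 * K))" using \<open>0 < \<epsilon>\<close> \<open>0 < K\<close> by simp
  ultimately obtain d2 where "0 < d2"
    and d2: "\<And>s'. \<bar>s' - s\<bar> < d2 \<Longrightarrow> cmod (?e s' - ?e s) < min 1 (\<epsilon> / (2 * K))"
    unfolding continuous_at_eps_delta dist_norm real_norm_def by metis
  have "q (rescaled c r U s' x - rescaled c r U s x) < \<epsilon>"
    if s': "\<tau> / r \<le> s'" "\<bar>s' - s\<bar> < min (d1 / r) d2" and x: "x \<in> B" for s' x
  proof -
    have "\<bar>r * s' - r * s\<bar> = r * \<bar>s' - s\<bar>"
      using r by (simp add: abs_mult flip: right_diff_distrib)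
    also have "\<dots> < d1" using s'(2) r by (simp add: less_divide_eq mult.commute)
    finally have U_small: "q (U (r * s') x - U (r * s) x) < \<epsilon> / (2 * L)"
      using s'(1) r x by (intro d1) (simp_all add: divide_simps mult.commute)
    have e_small: "cmod (?e s' - ?e s) < min 1 (\<epsilon> / (2 * K))" using d2 s'(2) by simp
    have "cmod (?e s') \<le> cmod (?e s' - ?e s) + cmod (?e s)"
      using norm_triangle_ineq[of "?e s' - ?e s" "?e s"] by simp
    then have "cmod (?e s') \<le> L" using e_small by (simp add: L_def)
    then have "cmod (?e s') * q (U (r * s') x - U (r * s) x) \<le> L * q (U (r * s') x - U (r * s) x)"
      by (rule mult_right_mono) (rule seminorm_nonneg[OF q])
    also have "\<dots> < L * (\<epsilon> / (2 * L))" using U_small \<open>0 < L\<close> by (rule mult_strict_left_mono)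
    finally have first: "cmod (?e s') * q (U (r * s') x - U (r * s) x) < \<epsilon> / 2" using \<open>0 < L\<close> by simp
    have "cmod (?e s' - ?e s) * q (U (r * s) x) \<le> \<epsilon> / (2 * K) * K"
      using e_small K[OF x] \<open>0 < \<epsilon>\<close> \<open>0 < K\<close>
      by (intro mult_mono) (auto simp: seminorm_nonneg[OF q])
    then have second: "cmod (?e s' - ?e s) * q (U (r * s) x) \<le> \<epsilon> / 2" using \<open>0 < K\<close> by simp
    have "rescaled c r U s' x - rescaled c r U s x =
        smul (?e s') (U (r * s') x - U (r * s) x) + smul (?e s' - ?e s) (U (r * s) x)"
      by (simp add: rescaled_def scale_right_diff_distrib scale_left_diff_distrib)
    then have "q (rescaled c r U s' x - rescaled c r U s x) \<le>
        cmod (?e s') * q (U (r * s') x - U (r * s) x) + cmod (?e s' - ?e s) * q (U (r * s) x)"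
      using seminorm_triangle[OF q, of "smul (?e s') (U (r * s') x - U (r * s) x)"
          "smul (?e s' - ?e s) (U (r * s) x)"]
      by (simp only: seminorm_smul[OF q])
    with first second show ?thesis by linarith
  qed
  then show "\<exists>\<delta>>0. \<forall>s'\<ge>\<tau> / r. \<bar>s' - s\<bar> < \<delta> \<longrightarrow> (\<forall>x\<in>B. q (rescaled c r U s' x - rescaled c r U s x) < \<epsilon>)"
    using \<open>0 < d1\<close> \<open>0 < d2\<close> r by (intro exI[of _ "min (d1 / r) d2"]) auto
qed

end

section \<open>The spectral mapping theorem\<close>

context equicontinuous_semigroup
begin

lemma generator_eqI:
  "(difference_quotient smul U x \<longlongrightarrow> v) (at_right 0) \<Longrightarrow> x \<in> generator_domain smul U \<and> generator smul U x = v"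
  unfolding generator_domain_def generator_def
  by (auto intro: tendsto_Lim trivial_limit_at_right_real)

lemma difference_quotient_generator:
  "x \<in> generator_domain smul U \<Longrightarrow> (difference_quotient smul U x \<longlongrightarrow> generator smul U x) (at_right 0)"
  using generator_eqI unfolding generator_domain_def by auto

text \<open>
  The same sequence works on both sides, by \<open>unit_time_estimate\<close> for the semigroup rescaled with
  \<open>\<mu>\<close>.
\<close>

lemma exp_generator_spectrum_subset:
  assumes t: "0 < t"
    and \<mu>: "\<mu> \<in> seq_bap_spectrum smul \<Gamma> (generator_domain smul U) (generator smul U)"
  shows "exp (complex_of_real t * \<mu>) \<in> seq_bap_spectrum smul \<Gamma> UNIV (U t)"
proof -
  obtain u where u: "range u \<subseteq> generator_domain smul U" "lcs_bounded \<Gamma> (range u)" "\<not> u \<longlonglongrightarrow> 0"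
    and lim: "(\<lambda>i. generator smul U (u i) - smul \<mu> (u i)) \<longlonglongrightarrow> 0"
    using \<mu> unfolding seq_bap_spectrum_def by blast
  define V where "V = rescaled (- (of_real t * \<mu>)) t U"
  interpret V: equicontinuous_semigroup smul \<Gamma> V
    unfolding V_def by (rule equicontinuous_semigroup_rescaled[OF t])
  let ?w = "\<lambda>i. smul (of_real t) (generator smul U (u i) - smul \<mu> (u i))"
  have dq: "(difference_quotient smul V (u i) \<longlongrightarrow> ?w i) (at_right 0)" for i
  proof -
    have "(difference_quotient smul V (u i) \<longlongrightarrow>
        smul (of_real t) (generator smul U (u i)) + smul (- (of_real t * \<mu>)) (u i)) (at_right 0)"
      unfolding V_def using u(1)
      by (intro difference_quotient_rescaled t difference_quotient_generator) auto
    then show ?thesis by (simp add: scale_right_diff_distrib)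
  qed
  have w: "?w \<longlonglongrightarrow> 0"
    using tendsto_smul[OF tendsto_const lim, of "of_real t"] by simp
  have "(\<lambda>i. V 1 (u i) - u i) \<longlonglongrightarrow> 0"
    unfolding tendsto_iff_seminorms
  proof
    fix q assume q: "q \<in> \<Gamma>"
    obtain p C where p: "p \<in> \<Gamma>" and "0 \<le> C"
      and C: "\<And>s x. 0 \<le> s \<Longrightarrow> s \<le> 1 \<Longrightarrow> q (V s x) \<le> C * p x"
      using V.equicontinuousE[OF q zero_le_one] by blast
    have "(\<lambda>i. C * p (?w i)) \<longlonglongrightarrow> C * p 0"
      by (intro tendsto_intros tendsto_seminorm[OF p] w)
    then have "(\<lambda>i. C * p (?w i)) \<longlonglongrightarrow> 0" by (simp add: seminorm_zero[OF p])
    then show "(\<lambda>i. q (V 1 (u i) - u i - 0)) \<longlonglongrightarrow> 0"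
      by (rule Lim_null_comparison[rotated])
        (simp add: seminorm_nonneg[OF q] V.unit_time_estimate[OF q p C dq])
  qed
  from tendsto_smul[OF tendsto_const this, of "exp (of_real t * \<mu>)"]
  have "(\<lambda>i. U t (u i) - smul (exp (of_real t * \<mu>)) (u i)) \<longlonglongrightarrow> 0"
    by (simp add: V_def rescaled_def scale_right_diff_distrib flip: exp_add)
  then show ?thesis
    using u unfolding seq_bap_spectrum_def by blast
qed

text \<open>
  The logarithms of \<open>\<nu>\<close> are \<open>c - 2 \<pi> \<i> k\<close>. For some \<open>k\<close> the Fourier coefficients \<open>y k\<close> of the orbits
  rescaled with \<open>c\<close> are not a null sequence, and these are approximate eigenvectors of the generator for the
  corresponding value \<open>\<mu>\<close>.
\<close>

lemma generator_spectrum_if_nonzero: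
  assumes complete: "sequentially_complete TYPE('a)"
    and U: "Lb_continuous_from \<tau> U" and "0 \<le> \<tau>" and t: "0 < t"
    and \<nu>: "\<nu> \<in> seq_bap_spectrum smul \<Gamma> UNIV (U t)" and "\<nu> \<noteq> 0"
  shows "\<exists>\<mu>\<in>seq_bap_spectrum smul \<Gamma> (generator_domain smul U) (generator smul U).
    \<nu> = exp (complex_of_real t * \<mu>)"
proof -
  obtain x where bounded: "lcs_bounded \<Gamma> (range x)" and x: "\<not> x \<longlonglongrightarrow> 0"
    and lim: "(\<lambda>i. U t (x i) - smul \<nu> (x i)) \<longlonglongrightarrow> 0"
    using \<nu> unfolding seq_bap_spectrum_def by blast
  obtain c where c: "exp c = \<nu>" using exp_Ln[OF \<open>\<nu> \<noteq> 0\<close>] by blast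
  \<comment> \<open>\<open>V 0\<close> has time-one map \<open>U t / \<nu>\<close>. The other \<open>V k\<close> are \<open>V 0\<close> times a Fourier mode: they have the
    same time-one map, and the means of their orbits are the Fourier coefficients for \<open>V 0\<close>.\<close>
  define V where "V k = rescaled (2 * of_real pi * \<i> * of_int k - c) t U" for k :: int
  have V: "equicontinuous_semigroup smul \<Gamma> (V k)" for k
    unfolding V_def by (rule equicontinuous_semigroup_rescaled[OF t])
  have V_mode: "V k s v = smul (fourier_mode k s) (V 0 s v)" for k s v
    by (simp add: V_def rescaled_def fourier_mode_def left_diff_distrib flip: exp_add)
  define z where "z i = V 0 1 (x i) - x i" for i
  have z_eq: "z i = smul (inverse \<nu>) (U t (x i) - smul \<nu> (x i))" for i
    using \<open>\<nu> \<noteq> 0\<close> by (simp add: z_def V_def rescaled_def exp_minus c scale_right_diff_distrib)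
  have z: "z \<longlonglongrightarrow> 0"
    using tendsto_smul[OF tendsto_const lim, of "inverse \<nu>"] by (simp add: z_eq[abs_def])
  have V_1: "V k 1 (x i) - x i = z i" for k i
    by (subst V_mode) (simp add: z_def fourier_mode_def exp_integer_2pi mult_ac)
  have "convergent (riemann_mean (\<lambda>s. V k s (x i)))" for k i
    by (rule convergent_riemann_mean[OF complete],
        rule continuous_on_subset[OF equicontinuous_semigroup.continuous_orbit[OF V]]) auto
  then obtain y where y: "\<And>k i. riemann_mean (\<lambda>s. V k s (x i)) \<longlonglongrightarrow> y k i"
    unfolding convergent_def by metis
  have "\<exists>k. \<not> y k \<longlonglongrightarrow> 0"
  proof (rule ccontr)
    assume "\<nexists>k. \<not> y k \<longlonglongrightarrow> 0"
    then have coefficients: "y k \<longlonglongrightarrow> 0" for k by blast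
    have "x \<longlonglongrightarrow> 0"
    proof (rule equicontinuous_semigroup.tendsto_zero_if_fourier_coefficients[OF V _ bounded])
      show "Lb_continuous_from (\<tau> / t) (V 0)"
        unfolding V_def by (rule Lb_continuous_from_rescaled[OF U \<open>0 \<le> \<tau>\<close> t])
      show "(\<lambda>i. V 0 1 (x i) - x i) \<longlonglongrightarrow> 0" using z by (simp add: z_def[abs_def])
      show "riemann_mean (\<lambda>s. smul (fourier_mode k s) (V 0 s (x i))) \<longlonglongrightarrow> y k i" for k i
        using y by (simp only: V_mode[symmetric])
    qed (rule coefficients)
    then show False using x by simp
  qed
  then obtain k where k: "\<not> y k \<longlonglongrightarrow> 0" by blast
  interpret V: equicontinuous_semigroup smul \<Gamma> "V k" by (rule V)
  define \<mu> where "\<mu> = (c - 2 * of_real pi * \<i> * of_int k) / of_real t"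
  \<comment> \<open>Undoing the rescaling transports the generator of \<open>V k\<close> at \<open>y k i\<close> back to the one of \<open>U\<close>.\<close>
  have "U = rescaled \<mu> (1 / t) (V k)"
    using t by (simp add: fun_eq_iff rescaled_def V_def \<mu>_def field_simps flip: exp_add)
  moreover have "(difference_quotient smul (rescaled \<mu> (1 / t) (V k)) (y k i) \<longlongrightarrow>
      smul (of_real (1 / t)) (z i) + smul \<mu> (y k i)) (at_right 0)" for i
    unfolding V_1[of k, symmetric]
    by (rule difference_quotient_rescaled[OF _ V.difference_quotient_riemann_mean[OF y]]) (simp add: t)
  ultimately have "(difference_quotient smul U (y k i) \<longlongrightarrow>
      smul (of_real (1 / t)) (z i) + smul \<mu> (y k i)) (at_right 0)" for i
    by simp
  then have gen: "y k i \<in> generator_domain smul U"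
    "generator smul U (y k i) = smul (of_real (1 / t)) (z i) + smul \<mu> (y k i)" for i
    using generator_eqI by blast+
  have "lcs_bounded \<Gamma> (range (y k))"
  proof (rule lcs_boundedI)
    fix q assume q: "q \<in> \<Gamma>"
    obtain p C where p: "p \<in> \<Gamma>" "0 \<le> C" and C: "\<And>s v. 0 \<le> s \<Longrightarrow> s \<le> 1 \<Longrightarrow> q (V k s v) \<le> C * p v"
      using V.equicontinuousE[OF q zero_le_one] by blast
    obtain M where M: "0 < M" "\<And>v. v \<in> range x \<Longrightarrow> p v \<le> M" using lcs_boundedE[OF bounded p(1)] by blast
    have "q (V k s (x i)) \<le> C * M" if "s \<in> {0..1}" for s i
      using C[of s "x i"] mult_left_mono[OF M(2) p(2), of "x i"] that by auto
    then have "q (riemann_mean (\<lambda>s. V k s (x i)) n) \<le> C * M" for i n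
      using M(1) p(2) by (intro seminorm_riemann_mean_le[OF q]) auto
    then have "q (y k i) \<le> C * M" for i
      by (intro tendsto_upperbound[OF tendsto_seminorm[OF q y]]) auto
    then show "\<exists>M. \<forall>v\<in>range (y k). q v \<le> M" by auto
  qed
  moreover have "(\<lambda>i. generator smul U (y k i) - smul \<mu> (y k i)) \<longlonglongrightarrow> 0"
    using tendsto_smul[OF tendsto_const z, of "of_real (1 / t)"] by (simp add: gen)
  ultimately have "\<mu> \<in> seq_bap_spectrum smul \<Gamma> (generator_domain smul U) (generator smul U)"
    using gen(1) k unfolding seq_bap_spectrum_def by blast
  moreover have "\<nu> = exp (complex_of_real t * \<mu>)"
    using t by (simp add: \<mu>_def exp_diff c exp_integer_2pi mult_ac)
  ultimately show ?thesis by blast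
qed

text \<open>
  A bounded sequence that does not tend to \<open>0\<close> exists in every nonzero space; stated in this form,
  the criterion applies directly to the sequences that witness a nonempty spectrum of the generator.
\<close>

lemma spectrum_identity:
  "seq_bap_spectrum smul \<Gamma> UNIV id = (if \<exists>u :: nat \<Rightarrow> 'a. lcs_bounded \<Gamma> (range u) \<and> \<not> u \<longlonglongrightarrow> 0 then {1} else {})"
proof -
  have "\<mu> = 1" if bounded: "\<not> u \<longlonglongrightarrow> 0" and lim: "(\<lambda>i. id (u i) - smul \<mu> (u i)) \<longlonglongrightarrow> 0"
    for \<mu> and u :: "nat \<Rightarrow> 'a"
  proof (rule ccontr)
    assume "\<mu> \<noteq> 1"
    have "smul (inverse (1 - \<mu>)) (id (u i) - smul \<mu> (u i)) = u i" for i
    proof -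
      have "id (u i) - smul \<mu> (u i) = smul (1 - \<mu>) (u i)" by (simp add: scale_left_diff_distrib)
      then show ?thesis using \<open>\<mu> \<noteq> 1\<close> by simp
    qed
    with tendsto_smul[OF tendsto_const lim, of "inverse (1 - \<mu>)"] bounded show False by simp
  qed
  then show ?thesis unfolding seq_bap_spectrum_def by auto
qed

end

theorem corollary5p16:
  fixes smul :: "complex \<Rightarrow> 'a::{topological_ab_group_add, t2_space} \<Rightarrow> 'a"
    and \<Gamma> :: "('a \<Rightarrow> real) set"
    and T :: "real \<Rightarrow> 'a \<Rightarrow> 'a"
    and t :: real
  assumes "locally_convex_space smul \<Gamma>"
    and "sequentially_complete TYPE('a)"
    and "op_semigroup smul T"
    and "eventually_uniformly_continuous smul \<Gamma> T"
    and "locally_equicontinuous \<Gamma> T"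
    and "t \<ge> 0"
    and "t = 0 \<Longrightarrow>
           seq_bap_spectrum smul \<Gamma> (generator_domain smul T) (generator smul T) \<noteq> {} \<or>
           (\<forall>x::'a. x = 0)"
  shows "seq_bap_spectrum smul \<Gamma> UNIV (T t) - {0} =
         exp_set t (seq_bap_spectrum smul \<Gamma> (generator_domain smul T) (generator smul T))"
proof -
  obtain \<tau> where "0 \<le> \<tau>" and cont: "continuous_map (top_of_set {\<tau>..}) (Lb_topology smul \<Gamma>) T"
    and strong: "strongly_continuous T"
    using assms(4) unfolding eventually_uniformly_continuous_def by blast
  interpret equicontinuous_semigroup smul \<Gamma> T
    using assms(1,3,5) strong
    by (intro equicontinuous_semigroup.intro equicontinuous_semigroup_axioms.intro)
  let ?\<sigma> = "seq_bap_spectrum smul \<Gamma> (generator_domain smul T) (generator smul T)"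
  show ?thesis
  proof (cases "t = 0")
    case True
    have T_t: "T t = id" using assms(3) True by (simp add: op_semigroup_def)
    show ?thesis
    proof (cases "?\<sigma> = {}")
      case False
      then have "\<exists>u :: nat \<Rightarrow> 'a. lcs_bounded \<Gamma> (range u) \<and> \<not> u \<longlonglongrightarrow> 0"
        unfolding seq_bap_spectrum_def by blast
      then show ?thesis using False True unfolding T_t by (auto simp: spectrum_identity exp_set_def)
    next
      case empty: True
      then have zero: "u = (\<lambda>_. 0)" for u :: "nat \<Rightarrow> 'a" using assms(7) True by auto
      have "u \<longlonglongrightarrow> 0" for u :: "nat \<Rightarrow> 'a" unfolding zero[of u] by simp
      then show ?thesis using empty by (simp add: T_t spectrum_identity exp_set_def)
    qed
  next
    case False
    then have t: "0 < t" using assms(6) by simp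
    have U: "Lb_continuous_from \<tau> T"
      by (rule Lb_continuous_fromI[OF \<open>0 \<le> \<tau>\<close> cont])
    show ?thesis
      unfolding exp_set_def
      using exp_generator_spectrum_subset[OF t]
        generator_spectrum_if_nonzero[OF assms(2) U \<open>0 \<le> \<tau>\<close> t]
      by (auto simp: image_iff)
  qed
qed

end
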